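(* Let $\varphi=(1+\sqrt5)/2$ and let $T$ be a finite root-shell system over $\mathbb{Z}[\varphi]$ that is indecomposable and non-crystallographic (i.e. some Cartan coefficient of $T$ does not lie in $\mathbb{Z}$). Then $$\operatorname{rank}(T)\in\{2,3,4\},$$ and the underlying reflection group $W=\langle r_\alpha:\alpha\in T\rangle$ is one of $H_2$, $H_3$, or $H_4$.
   Context: A root-shell system over a ring $R\subset\mathbb{R}$ is a finite subset $T$ of a Euclidean space $V$ such that (R1) $T=-T$; (R2) $T$ is contained in a single sphere $\{x\in V: \mathcal N(x)=1\}$ for the Euclidean (squared) norm $\mathcal N$, so all elements of $T$ have the same nonzero length; (R3) for every $\alpha\in T$ the reflection $r_\alpha(x)=x-\frac{2\langle x,\alpha\rangle}{\langle\alpha,\alpha\rangle}\alpha$ preserves $T$; (R4) the Cartan coefficients $\frac{2\langle\alpha,\beta\rangle}{\langle\alpha,\alpha\rangle}$ lie in $R$ for all $\alpha,\beta\in T$. $\operatorname{rank}(T)=\dim_{\mathbb{R}}\operatorname{span}_{\mathbb{R}}T$. $T$ is indecomposable if it is not the union of two nonempty mutually orthogonal subsets. $W$ is regarded as acting on $\operatorname{span}_{\mathbb{R}}T$. $H_2=I_2(5)$ (dihedral of order $10$), $H_3$ and $H_4$ are the non-crystallographic finite irreducible Coxeter groups of ranks $2,3,4$. *)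

theory Defs
  imports "HOL-Analysis.Analysis" "HOL-Computational_Algebra.Polynomial"
    "HOL-Algebra.Elementary_Groups" "HOL-Algebra.Bij"
begin

section \<open>Root-shell systems\<close>

definition reflection :: "'a::euclidean_space \<Rightarrow> 'a \<Rightarrow> 'a" where
  "reflection \<alpha> x = x - (2 * (x \<bullet> \<alpha>) / (\<alpha> \<bullet> \<alpha>)) *\<^sub>R \<alpha>"

definition cartan_coeff :: "'a::euclidean_space \<Rightarrow> 'a \<Rightarrow> real" where
  "cartan_coeff \<alpha> \<beta> = 2 * (\<alpha> \<bullet> \<beta>) / (\<alpha> \<bullet> \<alpha>)"

definition root_shell_system :: "real set \<Rightarrow> 'a::euclidean_space set \<Rightarrow> bool" where
  "root_shell_system R T \<longleftrightarrow>
     finite T \<and>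
     uminus ` T = T \<and>
     (\<forall>\<alpha>\<in>T. \<alpha> \<bullet> \<alpha> = 1) \<and>
     (\<forall>\<alpha>\<in>T. reflection \<alpha> ` T = T) \<and>
     (\<forall>\<alpha>\<in>T. \<forall>\<beta>\<in>T. cartan_coeff \<alpha> \<beta> \<in> R)"

definition rank_of :: "'a::euclidean_space set \<Rightarrow> nat" where
  "rank_of T = dim (span T)"

definition indecomposable :: "'a::euclidean_space set \<Rightarrow> bool" where
  "indecomposable T \<longleftrightarrow>
     \<not> (\<exists>A B. A \<noteq> {} \<and> B \<noteq> {} \<and> T = A \<union> B \<and> (\<forall>a\<in>A. \<forall>b\<in>B. orthogonal a b))"

definition crystallographic :: "'a::euclidean_space set \<Rightarrow> bool" where
  "crystallographic T \<longleftrightarrow> (\<forall>\<alpha>\<in>T. \<forall>\<beta>\<in>T. cartan_coeff \<alpha> \<beta> \<in> \<int>)"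

definition golden :: real ("\<phi>") where
  "\<phi> = (1 + sqrt 5) / 2"

definition int_adjoin :: "real \<Rightarrow> real set" ("\<int>[_]") where
  "\<int>[x] = range (\<lambda>p :: int poly. poly (map_poly of_int p) x)"


section \<open>The reflection group acting on the span\<close>

text \<open>Elements of the group are restricted to the span of \<open>T\<close>: they are extensional
  functions, undefined outside it.\<close>

definition refl_on_span :: "'a::euclidean_space set \<Rightarrow> 'a \<Rightarrow> 'a \<Rightarrow> 'a" where
  "refl_on_span U \<alpha> = restrict (reflection \<alpha>) U"

definition weyl_group :: "'a::euclidean_space set \<Rightarrow> ('a \<Rightarrow> 'a) monoid" where
  "weyl_group T = subgroup_generated (BijGroup (span T)) (refl_on_span (span T) ` T)"


section \<open>Coxeter groups by generators and relations\<close>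

text \<open>For a Coxeter matrix \<open>m\<close> on the index set \<open>{..<n}\<close>, the group has generators \<open>s\<^sub>0\<close>, ...,
  \<open>s\<^sub>n\<^sub>-\<^sub>1\<close> and relations \<open>(s\<^sub>i s\<^sub>j)^m(i,j) = 1\<close>. The generators are involutions since \<open>m(i,i) = 1\<close>,
  so words in the generators suffice and formal inverses are not needed.\<close>

inductive coxeter_eq :: "nat \<Rightarrow> (nat \<Rightarrow> nat \<Rightarrow> nat) \<Rightarrow> nat list \<Rightarrow> nat list \<Rightarrow> bool"
  for n :: nat and m :: "nat \<Rightarrow> nat \<Rightarrow> nat" where
  refl: "u \<in> lists {..<n} \<Longrightarrow> coxeter_eq n m u u"
| sym: "coxeter_eq n m u v \<Longrightarrow> coxeter_eq n m v u"
| trans: "coxeter_eq n m u v \<Longrightarrow> coxeter_eq n m v w \<Longrightarrow> coxeter_eq n m u w"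
| relator: "u \<in> lists {..<n} \<Longrightarrow> v \<in> lists {..<n} \<Longrightarrow> i < n \<Longrightarrow> j < n \<Longrightarrow>
    coxeter_eq n m (u @ concat (replicate (m i j) [i, j]) @ v) (u @ v)"

definition coxeter_class :: "nat \<Rightarrow> (nat \<Rightarrow> nat \<Rightarrow> nat) \<Rightarrow> nat list \<Rightarrow> nat list set" where
  "coxeter_class n m u = {v. coxeter_eq n m u v}"

definition coxeter_group :: "nat \<Rightarrow> (nat \<Rightarrow> nat \<Rightarrow> nat) \<Rightarrow> nat list set monoid" where
  "coxeter_group n m =
     \<lparr>carrier = coxeter_class n m ` lists {..<n},
      mult = \<lambda>A B. \<Union>u\<in>A. \<Union>v\<in>B. coxeter_class n m (u @ v),
      one = coxeter_class n m []\<rparr>"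

text \<open>Coxeter matrix of the diagram with \<open>n\<close> nodes in a path, the first edge labelled 5, the
  others unlabelled (label 3): \<open>H\<^sub>2 = I\<^sub>2(5)\<close>, \<open>H\<^sub>3\<close> and \<open>H\<^sub>4\<close> for \<open>n = 2, 3, 4\<close>.\<close>

definition H_matrix :: "nat \<Rightarrow> nat \<Rightarrow> nat" where
  "H_matrix i j =
     (if i = j then 1
      else if {i, j} = {0, 1} then 5
      else if i = Suc j \<or> j = Suc i then 3
      else 2)"

text \<open>A group \<open>W\<close> of transformations of \<open>U\<close> is the Coxeter group of \<open>m\<close> as a reflection group:
  \<open>U\<close> carries the canonical reflection representation of the Coxeter group, that is, it has a
  basis \<open>a\<^sub>0\<close>, ..., \<open>a\<^sub>n\<^sub>-\<^sub>1\<close> with \<open>a\<^sub>i \<bullet> a\<^sub>j = - cos (pi / m(i,j))\<close> (so \<open>a\<^sub>i\<close> is a unit vector), and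
  sending each generator \<open>s\<^sub>i\<close> to the reflection in \<open>a\<^sub>i\<close> gives an isomorphism onto \<open>W\<close>.\<close>

definition is_coxeter_reflection_group ::
    "nat \<Rightarrow> (nat \<Rightarrow> nat \<Rightarrow> nat) \<Rightarrow> 'a::euclidean_space set \<Rightarrow> ('a \<Rightarrow> 'a) monoid \<Rightarrow> bool" where
  "is_coxeter_reflection_group n m U W \<longleftrightarrow>
     (\<exists>(a :: nat \<Rightarrow> 'a) h.
        inj_on a {..<n} \<and> independent (a ` {..<n}) \<and> span (a ` {..<n}) = U \<and>
        (\<forall>i<n. \<forall>j<n. a i \<bullet> a j = - cos (pi / real (m i j))) \<and>
        h \<in> iso (coxeter_group n m) W \<and>
        (\<forall>i<n. h (coxeter_class n m [i]) = refl_on_span U (a i)))"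

definition is_H :: "nat \<Rightarrow> 'a::euclidean_space set \<Rightarrow> ('a \<Rightarrow> 'a) monoid \<Rightarrow> bool" where
  "is_H n U W \<longleftrightarrow> is_coxeter_reflection_group n H_matrix U W"

end

theory Submission
  imports Defs "HOL-Library.Multiset"
begin

text \<open>A finite root system has a simple system \<open>\<Delta>\<close>: a basis of its span, of pairwise
  non-acute roots, such that every root is a non-negative or a non-positive combination of \<open>\<Delta>\<close> and
  is the image of a member of \<open>\<Delta>\<close> under a product of reflections in \<open>\<Delta>\<close>. The theorem is a
  classification of the possible \<open>\<Delta>\<close>, followed by the identification of the group generated.

  \<^item> Labels (\<open>simple_label\<close>). For distinct simple roots \<open>a\<close>, \<open>b\<close> put \<open>t = - 2 a \<bullet> b\<close>. The roots obtained
  from \<open>a\<close> by reflecting alternately in \<open>b\<close> and \<open>a\<close> have Chebyshev polynomials in \<open>t\<close> as coordinates.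
  There are only finitely many roots, so these polynomials take finitely many values at \<open>t\<close>, hence
  also at the Galois conjugate \<open>t'\<close>; as they grow without bound outside \<open>[-2, 2]\<close>, \<open>t'\<close> lies in this interval. An
  integer \<open>x + y \<phi>\<close> of the golden field that lies in \<open>[0, 2)\<close> and has its conjugate in \<open>[-2, 2]\<close> is one of
  \<open>0\<close>, \<open>1\<close>, \<open>\<phi>\<close>, \<open>\<phi> - 1\<close>, and the last one would produce a root with coefficients of both signs. So the
  only labels of the Coxeter diagram are 2, 3 and 5.

  \<^item> Shape (\<open>simple_roots_form_H_chain\<close>). The diagram is connected because \<open>T\<close> is indecomposable, and it has
  an edge labelled 5, for otherwise all Cartan coefficients would be integers. Starting
  from this edge, the diagram is grown by one adjacent node at a time. Squares of explicit vectors
  must be non-negative, and this leaves one way to attach a third and a fourth node and no way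
  to attach a fifth.

  \<^item> Presentation (\<open>word_problem\<close>). The reflections in \<open>\<Delta>\<close> satisfy the Coxeter relations, and these suffice:
  a word with trivial product is a closed walk from \<open>\<rho>\<close> through the images of a regular
  vector \<open>\<rho>\<close>. Where the height \<open>- \<rho> \<bullet> w \<rho>\<close> has its maximum along the walk, the walk goes up by a
  reflection \<open>s\<^sub>i\<close> and down by \<open>s\<^sub>j\<close>, and
  the relation for \<open>i\<close>, \<open>j\<close> replaces this piece by the other way around a polygon
  with \<open>2 m\<^sub>i\<^sub>j\<close> vertices, all of whose other vertices are lower. Repeating this
  empties the word.\<close>

section \<open>Reflections and finite root systems\<close>

lemma reflection_unit: "\<alpha> \<bullet> \<alpha> = 1 \<Longrightarrow> reflection \<alpha> x = x - (2 * (x \<bullet> \<alpha>)) *\<^sub>R \<alpha>"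
  by (simp add: reflection_def)

lemma linear_reflection: "linear (reflection \<alpha>)"
  unfolding reflection_def
  by (intro linearI) (simp_all add: inner_add_left algebra_simps add_divide_distrib)

lemma reflection_reflection [simp]: "reflection \<alpha> (reflection \<alpha> x) = x"
  by (cases "\<alpha> = 0") (simp_all add: reflection_def inner_diff_left)

lemma inner_reflection: "reflection \<alpha> x \<bullet> reflection \<alpha> y = x \<bullet> y"
  by (cases "\<alpha> = 0")
    (simp_all add: reflection_def inner_diff_left inner_diff_right inner_commute)

lemma reflection_self: "\<alpha> \<noteq> 0 \<Longrightarrow> reflection \<alpha> \<alpha> = - \<alpha>"
  by (simp add: reflection_def scaleR_2)

lemma linear_foldr_reflection: "linear (foldr reflection xs)"
proof (induction xs)
  case Nil
  show ?case by (simp add: linear_iff)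
next
  case (Cons x xs)
  then show ?case using linear_compose[OF Cons linear_reflection] by (simp add: comp_def)
qed

lemma foldr_reflection_rev [simp]: "foldr reflection (rev xs) (foldr reflection xs v) = v"
  by (induction xs arbitrary: v) simp_all

lemma inner_foldr_reflection: "foldr reflection xs v \<bullet> foldr reflection xs w = v \<bullet> w"
  by (induction xs) (simp_all add: inner_reflection)

text \<open>Reflections are isometries, so they conjugate reflections to reflections. This turns statements
  about orbits of roots into statements about the generation of the group.\<close>

lemma reflection_foldr_conjugate:
  "reflection (foldr reflection xs \<alpha>) v =
     foldr reflection (xs @ [\<alpha>] @ rev xs) v"
proof -
  let ?f = "foldr reflection xs"
  define w where "w = foldr reflection (rev xs) v"
  have v: "v = ?f w"
    unfolding w_def using foldr_reflection_rev[of "rev xs"] by simp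
  have "?f (w - c *\<^sub>R \<alpha>) = ?f w - c *\<^sub>R ?f \<alpha>" for c
    using linear_foldr_reflection[of xs] by (simp add: linear_diff linear_scale)
  then have "reflection (?f \<alpha>) (?f w) = ?f (reflection \<alpha> w)"
    by (simp add: reflection_def inner_foldr_reflection)
  then have "reflection (?f \<alpha>) v = ?f (reflection \<alpha> w)"
    unfolding v .
  then show ?thesis unfolding w_def by (simp only: foldr_append foldr.simps comp_def id_def)
qed

locale root_system =
  fixes T :: "'a::euclidean_space set"
  assumes finite_roots: "finite T"
    and unit_root: "\<alpha> \<in> T \<Longrightarrow> \<alpha> \<bullet> \<alpha> = 1"
    and reflection_root: "\<alpha> \<in> T \<Longrightarrow> \<beta> \<in> T \<Longrightarrow> reflection \<alpha> \<beta> \<in> T"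
begin

lemma root_nonzero: "\<alpha> \<in> T \<Longrightarrow> \<alpha> \<noteq> 0"
  using unit_root by fastforce

lemma uminus_root: "\<alpha> \<in> T \<Longrightarrow> - \<alpha> \<in> T"
  using reflection_root[of \<alpha> \<alpha>] by (simp add: reflection_self root_nonzero)

lemma foldr_reflection_root: "xs \<in> lists T \<Longrightarrow> \<alpha> \<in> T \<Longrightarrow> foldr reflection xs \<alpha> \<in> T"
  by (induction xs) (auto intro: reflection_root)

lemma reflection_span: "\<alpha> \<in> T \<Longrightarrow> v \<in> span T \<Longrightarrow> reflection \<alpha> v \<in> span T"
  unfolding reflection_def by (intro span_diff span_scale) (auto intro: span_base)

lemma foldr_reflection_span: "xs \<in> lists T \<Longrightarrow> v \<in> span T \<Longrightarrow> foldr reflection xs v \<in> span T"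
  by (induction xs) (auto intro: reflection_span)

end

section \<open>Simple systems\<close>

definition nonneg_span :: "'a::real_vector set \<Rightarrow> 'a set" where
  "nonneg_span S = {v. \<exists>c. (\<forall>a\<in>S. 0 \<le> c a) \<and> v = (\<Sum>a\<in>S. c a *\<^sub>R a)}"

lemma nonneg_span_sum:
  assumes "\<And>i. i \<in> I \<Longrightarrow> f i \<in> nonneg_span S" and "\<And>i. i \<in> I \<Longrightarrow> 0 \<le> k i"
  shows "(\<Sum>i\<in>I. k i *\<^sub>R f i) \<in> nonneg_span S"
proof -
  obtain c where c: "\<And>i. i \<in> I \<Longrightarrow> (\<forall>a\<in>S. 0 \<le> c i a) \<and> f i = (\<Sum>a\<in>S. c i a *\<^sub>R a)"
    using assms(1) unfolding nonneg_span_def mem_Collect_eq by metis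
  have "(\<Sum>i\<in>I. k i *\<^sub>R f i) = (\<Sum>i\<in>I. \<Sum>a\<in>S. (k i * c i a) *\<^sub>R a)"
    using c by (simp add: scaleR_sum_right)
  also have "\<dots> = (\<Sum>a\<in>S. (\<Sum>i\<in>I. k i * c i a) *\<^sub>R a)"
    by (subst sum.swap) (simp add: scaleR_sum_left)
  finally show ?thesis
    unfolding nonneg_span_def using c assms(2)
    by (auto intro!: exI[of _ "\<lambda>a. \<Sum>i\<in>I. k i * c i a"] sum_nonneg mult_nonneg_nonneg)
qed

lemma nonneg_span_base: "finite S \<Longrightarrow> a \<in> S \<Longrightarrow> a \<in> nonneg_span S"
  unfolding nonneg_span_def
  by (auto intro!: exI[of _ "\<lambda>b. if b = a then 1 else 0"] simp: if_distrib[of "\<lambda>c. c *\<^sub>R _"] cong: if_cong)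

text \<open>Applied to the positive roots, a minimal generating set of their cone is the simple system. The
  finiteness of \<open>P\<close> provides a generating subset of least cardinality.\<close>

lemma exists_minimal_generators:
  assumes "finite P"
  obtains \<Delta> where "\<Delta> \<subseteq> P" "P \<subseteq> nonneg_span \<Delta>" "\<And>a. a \<in> \<Delta> \<Longrightarrow> a \<notin> nonneg_span (\<Delta> - {a})"
proof -
  let ?Q = "\<lambda>S. S \<subseteq> P \<and> P \<subseteq> nonneg_span S"
  have "?Q P" using nonneg_span_base assms by blast
  then obtain \<Delta> where \<Delta>: "?Q \<Delta>" and min: "\<And>S. ?Q S \<Longrightarrow> card \<Delta> \<le> card S"
    using ex_has_least_nat[of ?Q P card] by blast
  have "finite \<Delta>" using \<Delta> assms finite_subset by blast
  have "a \<notin> nonneg_span (\<Delta> - {a})" if "a \<in> \<Delta>" for a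
  proof
    assume "a \<in> nonneg_span (\<Delta> - {a})"
    then have b: "b \<in> nonneg_span (\<Delta> - {a})" if "b \<in> \<Delta>" for b
      using that nonneg_span_base[of "\<Delta> - {a}" b] \<open>finite \<Delta>\<close> by blast
    have "P \<subseteq> nonneg_span (\<Delta> - {a})"
    proof
      fix v assume "v \<in> P"
      then have "v \<in> nonneg_span \<Delta>" using \<Delta> by blast
      then obtain c where "\<forall>b\<in>\<Delta>. 0 \<le> c b" "v = (\<Sum>b\<in>\<Delta>. c b *\<^sub>R b)"
        unfolding nonneg_span_def by blast
      then show "v \<in> nonneg_span (\<Delta> - {a})" using nonneg_span_sum[of \<Delta> "\<lambda>b. b", OF b] by simp
    qed
    then have "card \<Delta> \<le> card (\<Delta> - {a})" using min \<Delta> by blast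
    then show False using that \<open>finite \<Delta>\<close> by (meson card_Diff1_less not_le)
  qed
  then show ?thesis using that \<Delta> by blast
qed

locale simple_system = root_system T for T :: "'a::euclidean_space set" +
  fixes \<rho> :: 'a and \<Delta> :: "'a set"
  assumes regular: "\<alpha> \<in> T \<Longrightarrow> \<rho> \<bullet> \<alpha> \<noteq> 0"
    and simple_root: "a \<in> \<Delta> \<Longrightarrow> a \<in> T"
    and simple_pos: "a \<in> \<Delta> \<Longrightarrow> 0 < \<rho> \<bullet> a"
    and pos_root: "\<alpha> \<in> T \<Longrightarrow> 0 < \<rho> \<bullet> \<alpha> \<Longrightarrow> \<alpha> \<in> nonneg_span \<Delta>"
    and simple_minimal: "a \<in> \<Delta> \<Longrightarrow> a \<notin> nonneg_span (\<Delta> - {a})"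
begin

lemma finite_simple: "finite \<Delta>"
  using simple_root by (intro finite_subset[OF _ finite_roots] subsetI)

text \<open>A simple root spans an extreme ray of the cone of the simple roots: otherwise the relation could be
  solved for it, against minimality. The regular vector \<open>\<rho>\<close> guarantees that the coefficient
  to divide by is positive.\<close>

lemma simple_extremal:
  assumes "\<beta> \<in> \<Delta>" and "\<forall>a\<in>\<Delta>. 0 \<le> d a" and "k *\<^sub>R \<beta> = (\<Sum>a\<in>\<Delta>. d a *\<^sub>R a)"
    and "\<gamma> \<in> \<Delta>" and "\<gamma> \<noteq> \<beta>"
  shows "d \<gamma> = 0"
proof (rule ccontr)
  assume "d \<gamma> \<noteq> 0"
  let ?S = "\<Delta> - {\<beta>}" and ?k = "k - d \<beta>"
  have eq: "?k *\<^sub>R \<beta> = (\<Sum>a\<in>?S. d a *\<^sub>R a)"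
    using assms(1,3) finite_simple by (simp add: sum.remove[of _ \<beta>] algebra_simps)
  have "0 < (\<Sum>a\<in>?S. d a * (\<rho> \<bullet> a))"
    using assms \<open>d \<gamma> \<noteq> 0\<close> finite_simple simple_pos
    by (intro sum_pos2[of _ \<gamma>]) (auto simp: less_le)
  also have "\<dots> = ?k * (\<rho> \<bullet> \<beta>)"
    using arg_cong[OF eq, of "inner \<rho>"] by (simp add: inner_sum_right)
  finally have k: "0 < ?k"
    using simple_pos[OF assms(1)] by (simp add: zero_less_mult_iff)
  have "\<beta> = (1 / ?k) *\<^sub>R (?k *\<^sub>R \<beta>)" using k by simp
  also have "\<dots> = (\<Sum>a\<in>?S. (d a / ?k) *\<^sub>R a)"
    unfolding eq by (simp add: scaleR_sum_right)
  finally have "\<beta> \<in> nonneg_span ?S"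
    unfolding nonneg_span_def using k assms(2)
    by (auto intro!: exI[of _ "\<lambda>a. d a / ?k"])
  then show False using simple_minimal assms(1) by blast
qed

lemma neg_root: "\<alpha> \<in> T \<Longrightarrow> \<not> 0 < \<rho> \<bullet> \<alpha> \<Longrightarrow> - \<alpha> \<in> nonneg_span \<Delta>"
  using pos_root[of "- \<alpha>"] uminus_root regular by (fastforce simp: less_le)

text \<open>Whichever of the two signs the root has, moving the term of the wrong sign to the other side contradicts
  the extremality of \<open>a\<close> or of \<open>b\<close>.\<close>

lemma no_mixed_root:
  assumes "a \<in> \<Delta>" "b \<in> \<Delta>" "a \<noteq> b" "0 < x" "0 < y"
  shows "x *\<^sub>R a - y *\<^sub>R b \<notin> T"
proof
  have sum: "(\<Sum>e\<in>\<Delta>. (c e + (if e = d then z else 0)) *\<^sub>R e) = (\<Sum>e\<in>\<Delta>. c e *\<^sub>R e) + z *\<^sub>R d"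
    if "d \<in> \<Delta>" for c d z
    using that finite_simple
    by (simp add: scaleR_add_left sum.distrib if_distrib[of "\<lambda>c. c *\<^sub>R _"] cong: if_cong)
  assume root: "x *\<^sub>R a - y *\<^sub>R b \<in> T" (is "?\<gamma> \<in> T")
  show False
  proof (cases "0 < \<rho> \<bullet> ?\<gamma>")
    case True
    then obtain c where c: "\<forall>e\<in>\<Delta>. 0 \<le> c e" "?\<gamma> = (\<Sum>e\<in>\<Delta>. c e *\<^sub>R e)"
      using pos_root[OF root] unfolding nonneg_span_def by blast
    have "c b + y = 0"
      using simple_extremal[of a "\<lambda>e. c e + (if e = b then y else 0)" x b] assms c
      by (simp add: sum diff_eq_eq)
    then show False using c assms by (smt (verit))
  next
    case False
    then obtain c where c: "\<forall>e\<in>\<Delta>. 0 \<le> c e" "- ?\<gamma> = (\<Sum>e\<in>\<Delta>. c e *\<^sub>R e)"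
      using neg_root[OF root] unfolding nonneg_span_def by blast
    have "c a + x = 0"
      using simple_extremal[of b "\<lambda>e. c e + (if e = a then x else 0)" y a] assms c
      by (simp add: sum c(2)[symmetric])
    then show False using c assms by (smt (verit))
  qed
qed

text \<open>At an acute angle, reflecting \<open>b\<close> in \<open>a\<close> subtracts a positive multiple of \<open>a\<close>, which gives a mixed root.\<close>

lemma simple_obtuse:
  assumes "a \<in> \<Delta>" "b \<in> \<Delta>" "a \<noteq> b"
  shows "a \<bullet> b \<le> 0"
proof (rule ccontr)
  assume "\<not> a \<bullet> b \<le> 0"
  then have "1 *\<^sub>R b - (2 * (b \<bullet> a)) *\<^sub>R a \<notin> T"
    using assms by (intro no_mixed_root) (auto simp: inner_commute)
  moreover have "reflection a b \<in> T"
    using assms simple_root reflection_root by blast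
  ultimately show False
    using assms simple_root by (simp add: reflection_unit unit_root)
qed

text \<open>Vectors in an open half-space at pairwise non-acute angles are independent: the positive
  and the negative part of a relation are the same vector, whose square is at most \<open>0\<close>.\<close>

lemma independent_simple: "independent \<Delta>"
proof
  assume "dependent \<Delta>"
  then obtain u w where w: "w \<in> \<Delta>" "u w \<noteq> 0" and u: "(\<Sum>v\<in>\<Delta>. u v *\<^sub>R v) = 0"
    using dependent_finite[OF finite_simple] by blast
  define p where "p = (\<lambda>v. max (u v) 0)"
  define q where "q = (\<lambda>v. max (- u v) 0)"
  have pq: "u v = p v - q v" "0 \<le> p v" "0 \<le> q v" "p v * q v = 0" for v
    by (auto simp: p_def q_def max_def)
  define x where "x = (\<Sum>v\<in>\<Delta>. p v *\<^sub>R v)"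
  have xq: "x = (\<Sum>v\<in>\<Delta>. q v *\<^sub>R v)"
    using u unfolding x_def pq(1) by (simp add: scaleR_diff_left sum_subtractf)
  have "x \<bullet> x = (\<Sum>v\<in>\<Delta>. p v *\<^sub>R v) \<bullet> (\<Sum>w\<in>\<Delta>. q w *\<^sub>R w)"
    using x_def xq by simp
  also have "\<dots> = (\<Sum>v\<in>\<Delta>. \<Sum>w\<in>\<Delta>. p v * (q w * (v \<bullet> w)))"
    by (simp add: inner_sum_left sum_distrib_left)
      (simp add: inner_sum_right sum_distrib_left mult.left_commute)
  also have "\<dots> \<le> 0"
  proof (intro sum_nonpos)
    fix v w assume vw: "v \<in> \<Delta>" "w \<in> \<Delta>"
    show "p v * (q w * (v \<bullet> w)) \<le> 0"
    proof (cases "v = w")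
      case True
      then show ?thesis using pq(4)[of w] by auto
    next
      case False
      then show ?thesis
        using simple_obtuse[OF vw] pq by (intro mult_nonneg_nonpos) auto
    qed
  qed
  finally have "x = 0" using inner_ge_zero[of x] inner_eq_zero_iff[of x] by linarith
  have zero: "c w = 0" if "\<And>v. 0 \<le> c v" "(\<Sum>v\<in>\<Delta>. c v *\<^sub>R v) = 0" for c :: "'a \<Rightarrow> real"
  proof -
    have "(\<Sum>v\<in>\<Delta>. c v * (\<rho> \<bullet> v)) = 0"
      using arg_cong[OF that(2), of "inner \<rho>"] by (simp add: inner_sum_right)
    then have "c w * (\<rho> \<bullet> w) = 0"
      using that(1) simple_pos finite_simple w(1)
      by (subst (asm) sum_nonneg_eq_0_iff) (auto intro!: mult_nonneg_nonneg simp: less_imp_le)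
    then show ?thesis using simple_pos[OF w(1)] by simp
  qed
  have "p w = 0" "q w = 0"
    using zero[of p] zero[of q] pq \<open>x = 0\<close> x_def xq by auto
  then show False using w pq(1)[of w] by simp
qed

text \<open>A positive root that is not simple makes an acute angle with some simple root;
  reflecting in that simple root lowers its height \<open>\<rho> \<bullet> \<alpha>\<close> and keeps it positive.\<close>

lemma pos_root_orbit:
  assumes "\<alpha> \<in> T" and "0 < \<rho> \<bullet> \<alpha>"
  shows "\<exists>xs\<in>lists \<Delta>. \<exists>a\<in>\<Delta>. \<alpha> = foldr reflection xs a"
  using assms
proof (induction "card {\<beta>\<in>T. 0 < \<rho> \<bullet> \<beta> \<and> \<rho> \<bullet> \<beta> < \<rho> \<bullet> \<alpha>}" arbitrary: \<alpha> rule: less_induct)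
  case less
  show ?case
  proof (cases "\<alpha> \<in> \<Delta>")
    case True
    then show ?thesis by (metis foldr.simps(1) id_apply lists.Nil)
  next
    case False
    obtain c where c: "\<forall>a\<in>\<Delta>. 0 \<le> c a" and \<alpha>: "\<alpha> = (\<Sum>a\<in>\<Delta>. c a *\<^sub>R a)"
      using pos_root less.prems unfolding nonneg_span_def by blast
    have "(\<Sum>a\<in>\<Delta>. c a * (\<alpha> \<bullet> a)) = \<alpha> \<bullet> \<alpha>"
      by (subst (3) \<alpha>) (simp add: inner_sum_right)
    then have "0 < (\<Sum>a\<in>\<Delta>. c a * (\<alpha> \<bullet> a))" using unit_root less.prems by simp
    then obtain a where a: "a \<in> \<Delta>" "0 < c a * (\<alpha> \<bullet> a)"
      by (meson not_le sum_nonpos)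
    then have pos: "0 < \<alpha> \<bullet> a"
      using c by (metis mult_nonneg_nonpos not_le)
    let ?\<gamma> = "reflection a \<alpha>"
    have \<gamma>: "?\<gamma> = \<alpha> - (2 * (\<alpha> \<bullet> a)) *\<^sub>R a" "?\<gamma> \<in> T"
      using a less.prems simple_root reflection_root by (simp_all add: reflection_unit unit_root)
    \<comment> \<open>The reflection changes the coefficient of \<open>a\<close> only, so the sign of the root could change only
      if \<open>\<alpha>\<close> were a multiple of \<open>a\<close>.\<close>
    have "0 < \<rho> \<bullet> ?\<gamma>"
    proof (rule ccontr)
      assume "\<not> 0 < \<rho> \<bullet> ?\<gamma>"
      then obtain d where d: "\<forall>a\<in>\<Delta>. 0 \<le> d a" "- ?\<gamma> = (\<Sum>a\<in>\<Delta>. d a *\<^sub>R a)"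
        using neg_root[OF \<gamma>(2)] unfolding nonneg_span_def by blast
      have "(2 * (\<alpha> \<bullet> a)) *\<^sub>R a = \<alpha> + - ?\<gamma>" using \<gamma> by simp
      also have "\<dots> = (\<Sum>a\<in>\<Delta>. (c a + d a) *\<^sub>R a)"
        unfolding d(2) by (subst \<alpha>) (simp add: scaleR_add_left sum.distrib)
      finally have "c b + d b = 0" if "b \<in> \<Delta>" "b \<noteq> a" for b
        using simple_extremal[of a "\<lambda>b. c b + d b" _ b] a(1) c d that by auto
      then have "c b = 0" if "b \<in> \<Delta>" "b \<noteq> a" for b
        using that c d by (metis add_nonneg_eq_0_iff)
      then have "\<alpha> = c a *\<^sub>R a"
        using \<alpha> a(1) finite_simple by (simp add: sum.remove)
      moreover from this have "c a * c a = 1"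
        using unit_root[OF less.prems(1)] unit_root[OF simple_root[OF a(1)]] by simp
      then have "c a = 1" using c a(1) by (force simp: square_eq_1_iff)
      ultimately show False using False a(1) by simp
    qed
    moreover have lt: "\<rho> \<bullet> ?\<gamma> < \<rho> \<bullet> \<alpha>"
      using pos simple_pos[OF a(1)] by (simp add: \<gamma>(1) inner_diff_right)
    moreover have "card {\<beta>\<in>T. 0 < \<rho> \<bullet> \<beta> \<and> \<rho> \<bullet> \<beta> < \<rho> \<bullet> ?\<gamma>} < card {\<beta>\<in>T. 0 < \<rho> \<bullet> \<beta> \<and> \<rho> \<bullet> \<beta> < \<rho> \<bullet> \<alpha>}"
      using calculation \<gamma>(2) finite_roots by (intro psubset_card_mono) auto
    ultimately obtain xs b where "xs \<in> lists \<Delta>" "b \<in> \<Delta>" "?\<gamma> = foldr reflection xs b"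
      using less.hyps \<gamma>(2) by blast
    moreover have "\<alpha> = reflection a ?\<gamma>" by simp
    ultimately show ?thesis
      using a(1) by (intro bexI[of _ "a # xs"] bexI[of _ b]) auto
  qed
qed

lemma root_orbit:
  assumes "\<alpha> \<in> T"
  obtains xs a where "xs \<in> lists \<Delta>" "a \<in> \<Delta>" "\<alpha> = foldr reflection xs a"
proof (cases "0 < \<rho> \<bullet> \<alpha>")
  case True
  then show ?thesis using pos_root_orbit assms that by blast
next
  case False
  then have "0 < \<rho> \<bullet> (- \<alpha>)" using regular[OF assms] by auto
  then obtain xs a where xs: "xs \<in> lists \<Delta>" "a \<in> \<Delta>" "- \<alpha> = foldr reflection xs a"
    using pos_root_orbit uminus_root assms by blast
  then have "\<alpha> = foldr reflection xs (- a)"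
    using linear_neg[OF linear_foldr_reflection] by (metis minus_minus)
  also have "\<dots> = foldr reflection (xs @ [a]) a"
    using xs by (simp add: reflection_self root_nonzero simple_root)
  finally show ?thesis using that[of "xs @ [a]" a] xs by simp
qed

lemma root_in_span_simple:
  assumes "\<alpha> \<in> T"
  shows "\<alpha> \<in> span \<Delta>"
proof -
  obtain xs a where xs: "xs \<in> lists \<Delta>" "a \<in> \<Delta>" "\<alpha> = foldr reflection xs a"
    using assms by (rule root_orbit)
  from xs(1) have "foldr reflection xs a \<in> span \<Delta>"
  proof (induction xs)
    case Nil
    then show ?case using xs(2) by (simp add: span_base)
  next
    case (Cons x xs)
    then show ?case by (auto simp: reflection_def intro: span_diff span_scale span_base)
  qed
  then show ?thesis using xs by simp
qed

lemma span_simple: "span \<Delta> = span T"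
proof -
  have "\<Delta> \<subseteq> span T" using simple_root span_base by blast
  moreover have "T \<subseteq> span \<Delta>" using root_in_span_simple by blast
  ultimately show ?thesis using span_eq by blast
qed

end

text \<open>Finitely many hyperplanes are a null set. Projecting to the span does not change the inner products with
  \<open>T\<close>; having \<open>\<rho>\<close> in the span makes its orbit under the reflection group finite.\<close>

lemma exists_regular_vector:
  fixes T :: "'a::euclidean_space set"
  assumes "finite T" and "0 \<notin> T"
  obtains \<rho> where "\<rho> \<in> span T" "\<And>\<alpha>. \<alpha> \<in> T \<Longrightarrow> \<rho> \<bullet> \<alpha> \<noteq> 0"
proof -
  have neg: "negligible (\<Union>\<alpha>\<in>T. {x. \<alpha> \<bullet> x = 0})"
  proof (rule negligible_Union)
    show "finite ((\<lambda>\<alpha>. {x. \<alpha> \<bullet> x = 0}) ` T)" using assms(1) by (rule finite_imageI)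
  next
    fix S assume "S \<in> (\<lambda>\<alpha>. {x. \<alpha> \<bullet> x = 0}) ` T"
    then obtain \<alpha> where "\<alpha> \<in> T" "S = {x. \<alpha> \<bullet> x = 0}" by (rule imageE)
    then show "negligible S" using negligible_hyperplane[of \<alpha> 0] assms(2) by metis
  qed
  have "(\<Union>\<alpha>\<in>T. {x. \<alpha> \<bullet> x = 0}) \<noteq> UNIV"
  proof
    assume "(\<Union>\<alpha>\<in>T. {x. \<alpha> \<bullet> x = 0}) = UNIV"
    with neg show False by (simp only: non_negligible_UNIV)
  qed
  then obtain x where "x \<notin> (\<Union>\<alpha>\<in>T. {x. \<alpha> \<bullet> x = 0})" by (auto simp: set_eq_iff)
  then have x: "\<alpha> \<bullet> x \<noteq> 0" if "\<alpha> \<in> T" for \<alpha> using that by simp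
  obtain y z where "y \<in> span T" "\<And>w. w \<in> span T \<Longrightarrow> orthogonal z w" "x = y + z"
    using orthogonal_subspace_decomp_exists by blast
  then show ?thesis
    using x by (intro that[of y])
      (auto simp: orthogonal_def inner_add_right inner_commute span_base)
qed

context root_system
begin

lemma exists_simple_system:
  obtains \<rho> \<Delta> where "\<rho> \<in> span T" "simple_system T \<rho> \<Delta>"
proof -
  have "0 \<notin> T" using root_nonzero by blast
  then obtain \<rho> where \<rho>: "\<rho> \<in> span T" "\<And>\<alpha>. \<alpha> \<in> T \<Longrightarrow> \<rho> \<bullet> \<alpha> \<noteq> 0"
    using exists_regular_vector[OF finite_roots] by metis
  define P where "P = {\<alpha>\<in>T. 0 < \<rho> \<bullet> \<alpha>}"
  have "finite P" using finite_roots by (simp add: P_def)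
  then obtain \<Delta> where \<Delta>: "\<Delta> \<subseteq> P" "P \<subseteq> nonneg_span \<Delta>"
    and min: "\<And>a. a \<in> \<Delta> \<Longrightarrow> a \<notin> nonneg_span (\<Delta> - {a})"
    using exists_minimal_generators by metis
  have "simple_system T \<rho> \<Delta>"
  proof
    fix \<alpha> assume "\<alpha> \<in> T" "0 < \<rho> \<bullet> \<alpha>"
    then have "\<alpha> \<in> P" by (simp add: P_def)
    then show "\<alpha> \<in> nonneg_span \<Delta>" using \<Delta>(2) by (rule rev_subsetD)
  next
    fix a assume "a \<in> \<Delta>"
    then have "a \<in> P" using \<Delta>(1) by (rule rev_subsetD)
    then show "a \<in> T" "0 < \<rho> \<bullet> a" by (simp_all add: P_def)
  qed (fact \<rho>(2) min)+
  then show ?thesis using that \<rho>(1) by blast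
qed

end

section \<open>Dihedral subgroups\<close>

primrec alternating :: "nat \<Rightarrow> 'b \<Rightarrow> 'b \<Rightarrow> 'b list" where
  "alternating 0 i j = []"
| "alternating (Suc k) i j = i # alternating k j i"

lemma concat_replicate_alternating: "concat (replicate k [i, j]) = alternating (2 * k) i j"
  by (induction k) simp_all

lemma map_alternating: "map f (alternating k i j) = alternating k (f i) (f j)"
  by (induction k arbitrary: i j) simp_all

lemma length_alternating [simp]: "length (alternating k i j) = k"
  by (induction k arbitrary: i j) simp_all

lemma take_alternating: "k \<le> l \<Longrightarrow> take k (alternating l i j) = alternating k i j"
proof (induction k arbitrary: l i j)
  case (Suc k)
  then show ?case by (cases l) simp_all
qed simp

lemma alternating_in_lists: "i \<in> A \<Longrightarrow> j \<in> A \<Longrightarrow> alternating k i j \<in> lists A"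
  by (induction k arbitrary: i j) simp_all

text \<open>The coordinates of \<open>v - w v\<close> with respect to two unit vectors \<open>a\<close>, \<open>b\<close> for the alternating
  product \<open>w\<close> of length \<open>k\<close> of their reflections, where \<open>t = - 2 a \<bullet> b\<close>, \<open>p = 2 v \<bullet> a\<close> and
  \<open>q = 2 v \<bullet> b\<close>. Peeling off the leftmost reflection exchanges the roles of \<open>a\<close> and \<open>b\<close>, hence the
  swaps in the recursion.\<close>

primrec dihedral_shift :: "real \<Rightarrow> nat \<Rightarrow> real \<Rightarrow> real \<Rightarrow> real \<times> real" where
  "dihedral_shift t 0 p q = (0, 0)"
| "dihedral_shift t (Suc k) p q = (case dihedral_shift t k q p of (y, x) \<Rightarrow> (p - x + t * y, y))"

lemma foldr_alternating:
  fixes a b v :: "'a::euclidean_space"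
  assumes "a \<bullet> a = 1" and "b \<bullet> b = 1" and "t = - 2 * (a \<bullet> b)"
  shows "foldr reflection (alternating k a b) v =
    v - fst (dihedral_shift t k (2 * (v \<bullet> a)) (2 * (v \<bullet> b))) *\<^sub>R a
      - snd (dihedral_shift t k (2 * (v \<bullet> a)) (2 * (v \<bullet> b))) *\<^sub>R b"
  using assms
proof (induction k arbitrary: a b)
  case (Suc k)
  obtain y x where yx: "dihedral_shift t k (2 * (v \<bullet> b)) (2 * (v \<bullet> a)) = (y, x)"
    by fastforce
  have "foldr reflection (alternating k b a) v = v - y *\<^sub>R b - x *\<^sub>R a"
    using Suc.IH[of b a] Suc.prems yx by (simp add: inner_commute)
  then have "foldr reflection (alternating (Suc k) a b) v = reflection a (v - y *\<^sub>R b - x *\<^sub>R a)"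
    by simp
  also have "\<dots> = v - y *\<^sub>R b - x *\<^sub>R a - (2 * (v \<bullet> a) + t * y - x - x) *\<^sub>R a"
    using Suc.prems by (simp add: reflection_unit inner_diff_left inner_commute algebra_simps)
  also have "\<dots> = v - (2 * (v \<bullet> a) - x + t * y) *\<^sub>R a - y *\<^sub>R b"
    by (simp add: algebra_simps flip: scaleR_2)
  finally have "foldr reflection (alternating (Suc k) a b) v =
      v - (2 * (v \<bullet> a) - x + t * y) *\<^sub>R a - y *\<^sub>R b" .
  moreover have "dihedral_shift t (Suc k) (2 * (v \<bullet> a)) (2 * (v \<bullet> b)) = (2 * (v \<bullet> a) - x + t * y, y)"
    by (simp add: yx)
  ultimately show ?case by (simp only: fst_conv snd_conv)
qed simp

lemma golden_square: "\<phi> * \<phi> = \<phi> + 1"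
  unfolding golden_def by (simp add: field_simps)

lemma golden_mult_mult: "\<phi> * (\<phi> * x) = \<phi> * x + x"
  using golden_square by (metis mult.assoc distrib_right mult_1)

lemma golden_pos: "0 < \<phi>"
  unfolding golden_def by (simp add: add_pos_pos)

text \<open>The label \<open>m\<close> is the order of the product of two reflections, and \<open>t = 2 cos (pi / m)\<close>.\<close>

inductive dihedral_label :: "nat \<Rightarrow> real \<Rightarrow> bool" where
  two: "dihedral_label 2 0"
| three: "dihedral_label 3 1"
| five: "dihedral_label 5 \<phi>"

text \<open>The relation \<open>(s\<^sub>a s\<^sub>b)\<^sup>m = 1\<close>: with arbitrary \<open>p\<close>, \<open>q\<close> no vector is moved. For each of the three orders it
  is a polynomial identity modulo \<open>\<phi>\<^sup>2 = \<phi> + 1\<close>.\<close>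

lemma dihedral_shift_full:
  assumes "dihedral_label m t"
  shows "dihedral_shift t (2 * m) p q = (0, 0)"
  using assms
  by cases (simp_all add: eval_nat_numeral algebra_simps golden_square golden_mult_mult)

text \<open>For a vector strictly on the positive side of \<open>a\<close> and \<open>b\<close>, every other member of its dihedral orbit
  arises from it by subtracting a nonzero vector of the cone of \<open>a\<close> and \<open>b\<close>. This is why the vertices of
  the polygon in the word problem are lower than its peak.\<close>

lemma dihedral_shift_nonneg:
  assumes "dihedral_label m t" and "0 < k" and "k < 2 * m" and "0 < p" and "0 < q"
    and "dihedral_shift t k p q = (x, y)"
  shows "0 \<le> x \<and> 0 \<le> y \<and> 0 < x + y"
  using assms(1)
proof cases
  case two
  then have "k \<in> {1, 2, 3}" using assms by auto
  then show ?thesis using assms two by (auto simp: eval_nat_numeral)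
next
  case three
  then have "k \<in> {1, 2, 3, 4, 5}" using assms by auto
  then show ?thesis using assms three by (auto simp: eval_nat_numeral)
next
  case five
  then have "k \<in> {1, 2, 3, 4, 5, 6, 7, 8, 9}" using assms by auto
  moreover have "0 < \<phi> * p" "0 < \<phi> * q" using golden_pos assms by auto
  ultimately show ?thesis using assms five
    by (auto simp: eval_nat_numeral algebra_simps golden_square golden_mult_mult)
qed

section \<open>The Coxeter presentation\<close>

declare coxeter_eq.trans [trans]

lemma coxeter_eq_lists:
  assumes "coxeter_eq n m u v" shows "u \<in> lists {..<n} \<and> v \<in> lists {..<n}"
  using assms
proof induction
  case (relator u v i j)
  then show ?case
    by (simp add: concat_replicate_alternating alternating_in_lists del: in_lists_conv_set)
qed auto

lemma coxeter_eq_append: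
  assumes "coxeter_eq n m u v" and "x \<in> lists {..<n}" and "y \<in> lists {..<n}"
  shows "coxeter_eq n m (x @ u @ y) (x @ v @ y)"
  using assms
proof induction
  case (refl u)
  then show ?case by (intro coxeter_eq.refl) simp
next
  case (sym u v)
  then show ?case by (blast intro: coxeter_eq.sym)
next
  case (trans u v w)
  then show ?case by (blast intro: coxeter_eq.trans)
next
  case (relator u v i j)
  then show ?case
    using coxeter_eq.relator[of "x @ u" n "v @ y" i j m] by simp
qed

lemma coxeter_eq_append2:
  assumes "coxeter_eq n m u u'" and "coxeter_eq n m v v'"
  shows "coxeter_eq n m (u @ v) (u' @ v')"
proof -
  have "coxeter_eq n m (u @ v) (u' @ v)"
    using coxeter_eq_append[OF assms(1), of "[]" v] coxeter_eq_lists assms by simp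
  also have "coxeter_eq n m (u' @ v) (u' @ v')"
    using coxeter_eq_append[OF assms(2), of u' "[]"] coxeter_eq_lists[OF assms(1)] by simp
  finally show ?thesis .
qed

text \<open>The word problem rests on two things: any two of the \<open>a\<^sub>i\<close> generate a dihedral group whose order is known
  from \<open>m\<close>, and a regular vector \<open>\<rho>\<close> tells whether a root, such as an image of some \<open>a\<^sub>i\<close>, is positive or negative.\<close>

locale coxeter_roots = root_system T for T :: "'a::euclidean_space set" +
  fixes \<rho> :: 'a and n :: nat and a :: "nat \<Rightarrow> 'a" and m :: "nat \<Rightarrow> nat \<Rightarrow> nat"
  assumes \<rho>_span: "\<rho> \<in> span T"
    and regular: "\<alpha> \<in> T \<Longrightarrow> \<rho> \<bullet> \<alpha> \<noteq> 0"
    and a_root: "i < n \<Longrightarrow> a i \<in> T"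
    and a_pos: "i < n \<Longrightarrow> 0 < \<rho> \<bullet> a i"
    and m_diag: "i < n \<Longrightarrow> m i i = 1"
    and label: "i < n \<Longrightarrow> j < n \<Longrightarrow> i \<noteq> j \<Longrightarrow> dihedral_label (m i j) (- 2 * (a i \<bullet> a j))"
begin

abbreviation act :: "nat list \<Rightarrow> 'a \<Rightarrow> 'a" where
  "act u \<equiv> foldr reflection (map a u)"

abbreviation words :: "nat list set" where
  "words \<equiv> lists {..<n}"

lemma map_a_lists: "u \<in> words \<Longrightarrow> map a u \<in> lists T"
  by (induction u) (auto intro: a_root)

lemma act_diff: "act u (v - w) = act u v - act u w"
  by (rule linear_diff[OF linear_foldr_reflection])

lemma act_scale: "act u (c *\<^sub>R v) = c *\<^sub>R act u v"
  by (rule linear_scale[OF linear_foldr_reflection])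

lemma act_root: "u \<in> words \<Longrightarrow> i < n \<Longrightarrow> act u (a i) \<in> T"
  using foldr_reflection_root map_a_lists a_root by blast

lemma act_relator:
  assumes "i < n" "j < n"
  shows "act (concat (replicate (m i j) [i, j])) v = v"
proof (cases "i = j")
  case True
  then show ?thesis using assms m_diag by simp
next
  case False
  show ?thesis
    unfolding concat_replicate_alternating map_alternating
      foldr_alternating[OF unit_root[OF a_root[OF assms(1)]] unit_root[OF a_root[OF assms(2)]] HOL.refl]
      dihedral_shift_full[OF label[OF assms False]]
    by simp
qed

lemma act_coxeter_eq:
  assumes "coxeter_eq n m u v" shows "act u = act v"
  using assms
proof induction
  case (relator u v i j)
  then show ?case using act_relator by (simp add: fun_eq_iff)
qed auto

text \<open>The vector \<open>\<rho>\<close> is the point of its orbit with the least height, since the group acts by isometries.\<close>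

definition height :: "nat list \<Rightarrow> real" where
  "height u = - (\<rho> \<bullet> act u \<rho>)"

lemma height_snoc:
  assumes "i < n"
  shows "height (p @ [i]) = height p + 2 * (\<rho> \<bullet> a i) * (\<rho> \<bullet> act p (a i))"
  unfolding height_def using assms a_root
  by (simp add: reflection_unit unit_root act_diff act_scale inner_diff_right)

text \<open>The action on \<open>\<rho>\<close> is determined by the induced map of the finite set \<open>T\<close> into itself, because \<open>\<rho>\<close> lies in
  the span of \<open>T\<close>.\<close>

lemma finite_heights: "finite (height ` words)"
proof -
  obtain c where c: "\<rho> = (\<Sum>\<alpha>\<in>T. c \<alpha> *\<^sub>R \<alpha>)"
    using \<rho>_span unfolding span_finite[OF finite_roots] by auto
  let ?G = "\<lambda>f. - (\<rho> \<bullet> (\<Sum>\<alpha>\<in>T. c \<alpha> *\<^sub>R f \<alpha>))"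
  have "height u \<in> ?G ` (T \<rightarrow>\<^sub>E T)" if "u \<in> words" for u
  proof
    show "restrict (act u) T \<in> T \<rightarrow>\<^sub>E T"
      using foldr_reflection_root[OF map_a_lists[OF that]] by (intro restrict_PiE[THEN iffD2] Pi_I)
    have "act u \<rho> = act u (\<Sum>\<alpha>\<in>T. c \<alpha> *\<^sub>R \<alpha>)"
      using c by (rule arg_cong)
    also have "\<dots> = (\<Sum>\<alpha>\<in>T. c \<alpha> *\<^sub>R act u \<alpha>)"
      unfolding linear_sum[OF linear_foldr_reflection] act_scale ..
    also have "\<dots> = (\<Sum>\<alpha>\<in>T. c \<alpha> *\<^sub>R restrict (act u) T \<alpha>)"
      by (intro sum.cong) simp_all
    finally show "height u = ?G (restrict (act u) T)"
      unfolding height_def by (rule arg_cong)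
  qed
  then have "height ` words \<subseteq> ?G ` (T \<rightarrow>\<^sub>E T)" by blast
  moreover have "finite (T \<rightarrow>\<^sub>E T)"
    using finite_roots by (intro finite_PiE) auto
  ultimately show ?thesis using finite_subset by blast
qed

text \<open>The heights met when the word \<open>u\<close> is read after the prefix \<open>p\<close>. The starting point \<open>p\<close> is left out, so that
  concatenation of words becomes addition of multisets.\<close>

primrec heights :: "nat list \<Rightarrow> nat list \<Rightarrow> real multiset" where
  "heights p [] = {#}"
| "heights p (i # u) = add_mset (height (p @ [i])) (heights (p @ [i]) u)"

lemma heights_append: "heights p (u @ v) = heights p u + heights (p @ u) v"
  by (induction u arbitrary: p) simp_all

lemma heights_cong: "act p = act p' \<Longrightarrow> heights p u = heights p' u"
proof (induction u arbitrary: p p')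
  case (Cons i u)
  have "act (p @ [i]) = act (p' @ [i])" using Cons.prems by (simp add: fun_eq_iff)
  then show ?case using Cons.IH by (simp add: height_def)
qed simp

lemma heights_elem:
  "x \<in># heights p u \<Longrightarrow> \<exists>k. 0 < k \<and> k \<le> length u \<and> x = height (p @ take k u)"
proof (induction u arbitrary: p)
  case (Cons i u)
  then consider "x = height (p @ [i])" | "x \<in># heights (p @ [i]) u" by auto
  then show ?case
  proof cases
    case 1
    then show ?thesis by (intro exI[of _ 1]) simp
  next
    case 2
    then obtain k where "0 < k" "k \<le> length u" "x = height ((p @ [i]) @ take k u)"
      using Cons.IH by blast
    then show ?thesis by (intro exI[of _ "Suc k"]) simp
  qed
qed simp

text \<open>Let \<open>w = p s\<^sub>i\<close> be the peak. Both neighbours \<open>w s\<^sub>i\<close> and \<open>w s\<^sub>j\<close> are lower exactly if \<open>w a\<^sub>i\<close> and \<open>w a\<^sub>j\<close> are negative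
  roots. The other vertices of the polygon are \<open>w (\<rho> - x a\<^sub>i - y a\<^sub>j)\<close> with \<open>x\<close>, \<open>y\<close> non-negative and not both
  zero, so they are lower, too.\<close>

lemma peak_reduction:
  assumes p: "p \<in> words" and ij: "i < n" "j < n"
    and up: "height p \<le> height (p @ [i])" and down: "height (p @ [i, j]) \<le> height (p @ [i])"
    and k: "0 < k" "k \<le> 2 * m j i - 2"
  shows "height (p @ alternating k j i) < height (p @ [i])"
proof -
  let ?w = "p @ [i]"
  have ne: "i \<noteq> j" using k ij m_diag by auto
  have "act ?w (a i) = - act p (a i)"
    using ij root_nonzero a_root linear_neg[OF linear_foldr_reflection]
    by (simp add: reflection_self)
  moreover have "0 \<le> \<rho> \<bullet> act p (a i)"
    using up ij a_pos[OF ij(1)] by (simp add: height_snoc zero_le_mult_iff)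
  ultimately have wi: "\<rho> \<bullet> act ?w (a i) < 0"
    using regular[OF act_root[OF p ij(1)]] by simp
  have "height (?w @ [j]) \<le> height ?w" using down by simp
  then have "\<rho> \<bullet> act ?w (a j) \<le> 0"
    using a_pos[OF ij(2)] unfolding height_snoc[OF ij(2)] by (simp add: mult_le_0_iff)
  then have wj: "\<rho> \<bullet> act ?w (a j) < 0"
    using regular[OF act_root[of ?w j]] p ij by (simp add: less_le)
  obtain x y where xy:
    "dihedral_shift (- 2 * (a j \<bullet> a i)) (Suc k) (2 * (\<rho> \<bullet> a i)) (2 * (\<rho> \<bullet> a j)) = (x, y)"
    by fastforce
  have nonneg: "0 \<le> x \<and> 0 \<le> y \<and> 0 < x + y"
    using label[of j i] ij ne k a_pos
    by (intro dihedral_shift_nonneg[OF _ _ _ _ _ xy]) auto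
  \<comment> \<open>Starting the alternating word one letter earlier cancels the last letter of \<open>w\<close>.\<close>
  have "act (p @ alternating k j i) \<rho> = act ?w (act (alternating (Suc k) i j) \<rho>)" by simp
  also have "act (alternating (Suc k) i j) \<rho> = \<rho> - x *\<^sub>R a i - y *\<^sub>R a j"
    unfolding map_alternating
    using foldr_alternating[OF unit_root unit_root, of "a i" "a j" "- 2 * (a j \<bullet> a i)"] xy ij a_root
    by (simp add: inner_commute del: alternating.simps dihedral_shift.simps)
  finally have "height (p @ alternating k j i) =
      height ?w + x * (\<rho> \<bullet> act ?w (a i)) + y * (\<rho> \<bullet> act ?w (a j))"
    unfolding height_def act_diff act_scale by (simp add: inner_diff_right)
  moreover have "x * (\<rho> \<bullet> act ?w (a i)) + y * (\<rho> \<bullet> act ?w (a j)) < 0"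
  proof (cases "x = 0")
    case True
    then show ?thesis using nonneg wj by (simp add: mult_pos_neg)
  next
    case False
    then have "x * (\<rho> \<bullet> act ?w (a i)) < 0" using nonneg wi by (simp add: mult_pos_neg)
    moreover have "y * (\<rho> \<bullet> act ?w (a j)) \<le> 0" using nonneg wj by (simp add: mult_nonneg_nonpos)
    ultimately show ?thesis by simp
  qed
  ultimately show ?thesis by simp
qed

text \<open>Insert the relator \<open>(s\<^sub>j s\<^sub>i)\<^sup>m\<close> behind \<open>s\<^sub>i s\<^sub>j\<close> and cancel the squares of \<open>s\<^sub>j\<close> and \<open>s\<^sub>i\<close>. For \<open>i = j\<close> the
  remaining word is empty and this is just the cancellation of \<open>s\<^sub>i s\<^sub>i\<close>, so both cases of the word problem are covered.\<close>

lemma coxeter_eq_braid: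
  assumes p: "p \<in> words" and q: "q \<in> words" and ij: "i < n" "j < n" and pos: "0 < m j i"
  shows "coxeter_eq n m (p @ [i, j] @ q) (p @ alternating (2 * m j i - 2) j i @ q)"
proof -
  let ?r = "alternating (2 * m j i - 2) j i"
  have r: "?r \<in> words" using ij by (simp add: alternating_in_lists del: in_lists_conv_set)
  obtain l where l: "m j i = Suc l" using pos gr0_implies_Suc by blast
  have "coxeter_eq n m (p @ [i, j] @ q) ((p @ [i, j]) @ concat (replicate (m j i) [j, i]) @ q)"
    using coxeter_eq.sym[OF coxeter_eq.relator[of "p @ [i, j]" n q j i m]] p q ij by simp
  also have "(p @ [i, j]) @ concat (replicate (m j i) [j, i]) @ q =
      (p @ [i]) @ concat (replicate (m j j) [j, j]) @ ([i] @ ?r @ q)"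
    using ij m_diag l by (simp add: concat_replicate_alternating)
  also have "coxeter_eq n m \<dots> ((p @ [i]) @ ([i] @ ?r @ q))"
    using p q ij r by (intro coxeter_eq.relator) auto
  also have "(p @ [i]) @ ([i] @ ?r @ q) = p @ concat (replicate (m i i) [i, i]) @ (?r @ q)"
    using ij m_diag by simp
  also have "coxeter_eq n m \<dots> (p @ (?r @ q))"
    using p q ij r by (intro coxeter_eq.relator) auto
  finally show ?thesis by simp
qed

text \<open>Induction along the multiset of heights: rewriting at the peak replaces its height by
  finitely many smaller ones. As only finitely many heights occur, the multiset extension of
  their order is well-founded.\<close>

theorem word_problem:
  assumes "u \<in> words" and "act u \<rho> = \<rho>"
  shows "coxeter_eq n m u []"
proof -
  define X where "X = height ` words"
  define r where "r = {(x, y). x \<in> X \<and> y \<in> X \<and> x < (y::real)}"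
  have "finite X" using finite_heights by (simp add: X_def)
  have "wf r"
  proof (rule wf_subset[OF Wellfounded.wf_measure[of "\<lambda>y. card {x\<in>X. x < y}"]])
    show "r \<subseteq> Wellfounded.measure (\<lambda>y. card {x\<in>X. x < y})"
      using \<open>finite X\<close> by (auto simp: r_def intro!: psubset_card_mono)
  qed
  then have "wf (inv_image (Multiset.mult r) (heights []))"
    by (intro wf_inv_image wf_mult)
  then show ?thesis using assms
  proof (induction u rule: wf_induct_rule)
    case (less u)
    show ?case
    proof (cases u)
      case Nil
      then show ?thesis by (simp add: coxeter_eq.refl)
    next
      case (Cons i0 u0)
      let ?H = "\<lambda>k. height (take k u)"
      have i0: "i0 < n" using less.prems Cons by simp
      \<comment> \<open>The walk starts and ends at the minimum and leaves it, so its peak is inside.\<close>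
      have "?H 0 < ?H 1"
        using height_snoc[OF i0, of "[]"] a_pos[OF i0] Cons by simp
      have "?H (length u) = ?H 0"
        using less.prems by (simp add: height_def)
      have "Max (?H ` {..length u}) \<in> ?H ` {..length u}"
        by (intro Max_in) auto
      then obtain k where k: "k \<le> length u" "?H k = Max (?H ` {..length u})"
        by force
      then have max: "?H l \<le> ?H k" if "l \<le> length u" for l
        using that by simp
      have "?H 0 < ?H k"
        using \<open>?H 0 < ?H 1\<close> max[of 1] Cons by simp
      then have "0 < k" "k \<noteq> length u"
        using \<open>?H (length u) = ?H 0\<close> by (metis less_irrefl neq0_conv)+
      then have "k < length u" using k by simp
      obtain l where l: "k = Suc l" using \<open>0 < k\<close> gr0_implies_Suc by blast
      define p q i j where "p = take l u" and "q = drop (Suc k) u" and "i = u ! l" and "j = u ! k"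
      have pi: "take k u = p @ [i]"
        using \<open>k < length u\<close> by (simp add: l p_def i_def take_Suc_conv_app_nth)
      have pij: "take (Suc k) u = p @ [i, j]"
        using \<open>k < length u\<close> pi by (simp add: j_def take_Suc_conv_app_nth)
      have u: "u = p @ [i, j] @ q"
        using append_take_drop_id[of "Suc k" u] unfolding pij q_def by simp
      have p: "p \<in> words" and q: "q \<in> words" and i: "i < n" and j: "j < n"
        using less.prems(1) unfolding u by auto
      have up: "height p \<le> height (p @ [i])"
        using max[of l] \<open>k < length u\<close> pi by (simp add: l p_def)
      have down: "height (p @ [i, j]) \<le> height (p @ [i])"
        using max[of "Suc k"] \<open>k < length u\<close> pi pij by simp
      have "0 < m j i"
        using m_diag[OF j] label[OF j i] by (cases "i = j") (auto elim: dihedral_label.cases)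
      define w where "w = alternating (2 * m j i - 2) j i"
      have w: "w \<in> words"
        unfolding w_def using i j by (simp add: alternating_in_lists del: in_lists_conv_set)
      have eq: "coxeter_eq n m u (p @ w @ q)"
        unfolding w_def u by (rule coxeter_eq_braid[OF p q i j \<open>0 < m j i\<close>])
      have "coxeter_eq n m (p @ [i, j]) (p @ w)"
        using coxeter_eq_braid[OF p _ i j \<open>0 < m j i\<close>, of "[]"] unfolding w_def by simp
      then have same: "heights (p @ w) q = heights (p @ [i, j]) q"
        by (intro heights_cong act_coxeter_eq[symmetric])
      define I where "I = heights [] p + heights (p @ [i, j]) q"
      have new: "heights [] (p @ w @ q) = I + heights p w"
        by (simp add: I_def heights_append same)
      have old: "heights [] u = I + {#height (p @ [i]), height (p @ [i, j])#}"
        unfolding u I_def by (simp add: heights_append)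
      have "(x, height (p @ [i])) \<in> r" if x: "x \<in># heights p w" for x
      proof -
        obtain k where k: "0 < k" "k \<le> length w" "x = height (p @ take k w)"
          using heights_elem[OF x] by blast
        then have "x = height (p @ alternating k j i)"
          by (simp add: w_def take_alternating)
        then have "x < height (p @ [i])"
          using k peak_reduction[OF p i j up down] by (simp add: w_def)
        moreover have "p @ take k w \<in> words" "p @ [i] \<in> words"
          using p w i by (auto dest: in_set_takeD)
        ultimately show ?thesis using k(3) by (auto simp: r_def X_def)
      qed
      then have "(heights [] (p @ w @ q), heights [] u) \<in> Multiset.mult r"
        unfolding old new by (intro one_step_implies_mult) auto
      moreover have "act (p @ w @ q) \<rho> = \<rho>"
        using act_coxeter_eq[OF eq] less.prems by metis
      moreover have "p @ w @ q \<in> words" using p w q by simp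
      ultimately have "coxeter_eq n m (p @ w @ q) []"
        using less.IH by simp
      then show ?thesis using eq coxeter_eq.trans by blast
    qed
  qed
qed

end

section \<open>The reflection group as a Coxeter group\<close>

context root_system
begin

lemma foldr_reflection_Bij:
  assumes "xs \<in> lists T"
  shows "restrict (foldr reflection xs) (span T) \<in> Bij (span T)"
proof -
  have maps: "foldr reflection ys v \<in> span T" if "set ys = set xs" "v \<in> span T" for ys v
    using that assms foldr_reflection_span by (simp add: in_lists_conv_set)
  have "bij_betw (foldr reflection xs) (span T) (span T)"
  proof (rule bij_betw_byWitness[where f' = "foldr reflection (rev xs)"])
    show "\<forall>v\<in>span T. foldr reflection xs (foldr reflection (rev xs) v) = v"
      using foldr_reflection_rev[of "rev xs"] by simp
  qed (use maps in auto)
  then show ?thesis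
    by (simp add: Bij_def cong: bij_betw_cong)
qed

lemma mult_BijGroup_foldr:
  assumes "xs \<in> lists T" and "ys \<in> lists T"
  shows "restrict (foldr reflection xs) (span T) \<otimes>\<^bsub>BijGroup (span T)\<^esub> restrict (foldr reflection ys) (span T)
    = restrict (foldr reflection (xs @ ys)) (span T)"
  using assms foldr_reflection_Bij foldr_reflection_span[OF assms(2)]
  by (auto simp: BijGroup_def compose_def restrict_def fun_eq_iff)

lemma refl_on_span_eq: "refl_on_span (span T) \<alpha> = restrict (foldr reflection [\<alpha>]) (span T)"
  by (simp add: refl_on_span_def restrict_def fun_eq_iff)

lemma carrier_weyl_group:
  "carrier (weyl_group T) = (\<lambda>xs. restrict (foldr reflection xs) (span T)) ` lists T"
    (is "_ = ?f ` _")
proof -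
  let ?G = "BijGroup (span T)"
  interpret G: group ?G by (rule group_BijGroup)
  let ?S = "refl_on_span (span T) ` T"
  have S: "?S \<subseteq> carrier ?G"
    using foldr_reflection_Bij by (auto simp: refl_on_span_eq BijGroup_def simp del: foldr.simps)
  have f_one: "?f [] = \<one>\<^bsub>?G\<^esub>"
    by (simp add: BijGroup_def restrict_def fun_eq_iff)
  have mult: "?f xs \<otimes>\<^bsub>?G\<^esub> ?f ys = ?f (xs @ ys)" if "xs \<in> lists T" "ys \<in> lists T" for xs ys
    using that by (rule mult_BijGroup_foldr)
  have "?f xs \<in> generate ?G ?S" if "xs \<in> lists T" for xs
    using that
  proof (induction xs)
    case Nil
    then show ?case unfolding f_one by (rule generate.one)
  next
    case (Cons \<alpha> xs)
    have "?f [\<alpha>] \<in> generate ?G ?S"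
      using Cons.hyps by (intro generate.incl) (auto simp: refl_on_span_eq)
    then have "?f [\<alpha>] \<otimes>\<^bsub>?G\<^esub> ?f xs \<in> generate ?G ?S"
      using Cons.IH by (rule generate.eng)
    also have "?f [\<alpha>] \<otimes>\<^bsub>?G\<^esub> ?f xs = ?f ([\<alpha>] @ xs)"
      using Cons.hyps by (intro mult) simp_all
    finally show ?case by (simp only: append_Cons append_Nil)
  qed
  moreover have "g \<in> ?f ` lists T" if "g \<in> generate ?G ?S" for g
    using that
  proof induction
    case one
    show ?case unfolding f_one[symmetric] by (intro imageI) simp
  next
    case (incl h)
    then obtain \<alpha> where "\<alpha> \<in> T" "h = ?f [\<alpha>]" by (auto simp: refl_on_span_eq)
    then show ?case by (intro image_eqI[of _ _ "[\<alpha>]"]) simp_all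
  next
    case (inv h)
    then obtain \<alpha> where \<alpha>: "\<alpha> \<in> T" "h = ?f [\<alpha>]" by (auto simp: refl_on_span_eq)
    then have "?f [\<alpha>] \<otimes>\<^bsub>?G\<^esub> ?f [\<alpha>] = ?f ([\<alpha>] @ [\<alpha>])" by (intro mult) simp_all
    also have "\<dots> = ?f []" by (simp add: restrict_def fun_eq_iff)
    finally have "h \<otimes>\<^bsub>?G\<^esub> h = \<one>\<^bsub>?G\<^esub>" unfolding f_one \<alpha>(2) .
    moreover have "h \<in> carrier ?G" using inv S by blast
    ultimately have "inv\<^bsub>?G\<^esub> h = h" by (intro G.inv_equality)
    then show ?case using \<alpha> by (intro image_eqI[of _ _ "[\<alpha>]"]) simp_all
  next
    case (eng h1 h2)
    then obtain xs ys where xys: "xs \<in> lists T" "ys \<in> lists T" and h: "h1 = ?f xs" "h2 = ?f ys"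
      by blast
    show ?case unfolding h mult[OF xys] using xys by (intro imageI) simp
  qed
  ultimately show ?thesis
    unfolding weyl_group_def carrier_subgroup_generated Int_absorb1[OF S] by blast
qed

end

context coxeter_roots
begin

definition word_map :: "nat list \<Rightarrow> 'a \<Rightarrow> 'a" where
  "word_map u = restrict (act u) (span T)"

text \<open>If the products of \<open>u\<close> and \<open>v\<close> agree, then \<open>u v\<inverse>\<close> has trivial product and is trivial by the word problem;
  the inverse of a word is its reversal.\<close>

lemma word_map_eq_iff:
  assumes "u \<in> words" "v \<in> words"
  shows "word_map u = word_map v \<longleftrightarrow> coxeter_eq n m u v"
proof
  assume "coxeter_eq n m u v"
  then show "word_map u = word_map v" unfolding word_map_def by (simp add: act_coxeter_eq)
next
  assume "word_map u = word_map v"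
  moreover have "act (rev v) \<rho> \<in> span T"
    using assms by (intro foldr_reflection_span[OF map_a_lists \<rho>_span]) (simp add: in_lists_conv_set)
  ultimately have "act u (act (rev v) \<rho>) = act v (act (rev v) \<rho>)"
    unfolding word_map_def by (metis restrict_apply')
  also have "\<dots> = \<rho>" using foldr_reflection_rev[of "rev (map a v)"] by (simp add: rev_map)
  finally have "coxeter_eq n m (u @ rev v) []"
    using assms by (intro word_problem) auto
  then have "coxeter_eq n m ((u @ rev v) @ v) ([] @ v)"
    by (rule coxeter_eq_append2[OF _ coxeter_eq.refl[OF assms(2)]])
  then have left: "coxeter_eq n m (u @ rev v @ v) v" by simp
  have "coxeter_eq n m (rev v @ v) []"
    using assms foldr_reflection_rev[of "map a v"]
    by (intro word_problem) (auto simp: rev_map)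
  then have "coxeter_eq n m (u @ (rev v @ v)) (u @ [])"
    by (rule coxeter_eq_append2[OF coxeter_eq.refl[OF assms(1)]])
  then have "coxeter_eq n m (u @ rev v @ v) u" by simp
  then show "coxeter_eq n m u v"
    using left by (rule coxeter_eq.trans[OF coxeter_eq.sym])
qed

text \<open>The isomorphism, defined by a representative; \<open>word_map_eq_iff\<close> makes the choice irrelevant.\<close>

definition class_map :: "nat list set \<Rightarrow> 'a \<Rightarrow> 'a" where
  "class_map A = word_map (SOME u. u \<in> A)"

lemma class_map_class:
  assumes "u \<in> words"
  shows "class_map (coxeter_class n m u) = word_map u"
proof -
  have "coxeter_eq n m u (SOME v. v \<in> coxeter_class n m u)"
    unfolding coxeter_class_def mem_Collect_eq
    using assms coxeter_eq.refl by (rule_tac someI) blast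
  then show ?thesis
    using assms coxeter_eq_lists unfolding class_map_def by (metis word_map_eq_iff)
qed

lemma coxeter_class_eq_iff:
  assumes "u \<in> words"
  shows "coxeter_class n m u = coxeter_class n m v \<longleftrightarrow> coxeter_eq n m u v"
  unfolding coxeter_class_def
  using assms by (blast intro: coxeter_eq.refl coxeter_eq.sym coxeter_eq.trans)

lemma mult_coxeter_class:
  assumes "u \<in> words" "v \<in> words"
  shows "coxeter_class n m u \<otimes>\<^bsub>coxeter_group n m\<^esub> coxeter_class n m v = coxeter_class n m (u @ v)"
proof -
  have "coxeter_class n m (u' @ v') = coxeter_class n m (u @ v)"
    if "u' \<in> coxeter_class n m u" "v' \<in> coxeter_class n m v" for u' v'
  proof -
    have "coxeter_eq n m (u @ v) (u' @ v')"
      using that by (intro coxeter_eq_append2) (simp_all add: coxeter_class_def)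
    then show ?thesis
      using assms coxeter_class_eq_iff[of "u @ v" "u' @ v'"] by simp
  qed
  then have "(\<Union>u'\<in>coxeter_class n m u. \<Union>v'\<in>coxeter_class n m v. coxeter_class n m (u' @ v')) =
      (\<Union>u'\<in>coxeter_class n m u. \<Union>v'\<in>coxeter_class n m v. coxeter_class n m (u @ v))"
    by (intro SUP_cong HOL.refl)
  moreover have "u \<in> coxeter_class n m u" "v \<in> coxeter_class n m v"
    using assms by (auto simp: coxeter_class_def coxeter_eq.refl)
  then have "coxeter_class n m u \<noteq> {}" "coxeter_class n m v \<noteq> {}" by blast+
  ultimately show ?thesis by (simp add: coxeter_group_def)
qed

lemma class_map_iso:
  assumes orbit: "\<And>\<alpha>. \<alpha> \<in> T \<Longrightarrow> \<exists>u\<in>words. \<exists>i<n. \<alpha> = act u (a i)"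
  shows "class_map \<in> iso (coxeter_group n m) (weyl_group T)"
proof -
  have carrier: "carrier (coxeter_group n m) = coxeter_class n m ` words"
    by (simp add: coxeter_group_def)
  have word: "\<exists>u\<in>words. foldr reflection xs = act u" if "xs \<in> lists T" for xs
    using that
  proof (induction xs)
    case Nil
    show ?case by (intro bexI[of _ "[]"]) simp_all
  next
    case (Cons \<alpha> xs)
    then obtain u v i where u: "u \<in> words" "foldr reflection xs = act u"
      and v: "v \<in> words" "i < n" "\<alpha> = act v (a i)"
      using orbit[of \<alpha>] by blast
    have "foldr reflection (\<alpha> # xs) w = act (v @ [i] @ rev v @ u) w" for w
      using reflection_foldr_conjugate[of "map a v" "a i" "act u w"] u v by (simp add: rev_map)
    then show ?case
      using u v by (intro bexI[of _ "v @ [i] @ rev v @ u"]) auto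
  qed
  have image: "carrier (weyl_group T) = word_map ` words"
  proof
    show "carrier (weyl_group T) \<subseteq> word_map ` words"
    proof
      fix g assume "g \<in> carrier (weyl_group T)"
      then obtain xs where "xs \<in> lists T" "g = restrict (foldr reflection xs) (span T)"
        unfolding carrier_weyl_group by blast
      then show "g \<in> word_map ` words"
        using word[of xs] unfolding word_map_def by auto
    qed
    show "word_map ` words \<subseteq> carrier (weyl_group T)"
      unfolding carrier_weyl_group word_map_def using map_a_lists by blast
  qed
  show ?thesis
  proof (rule isoI)
    show "class_map \<in> hom (coxeter_group n m) (weyl_group T)"
    proof (rule homI)
      fix A assume "A \<in> carrier (coxeter_group n m)"
      then obtain u where "u \<in> words" "A = coxeter_class n m u"
        unfolding carrier by blast
      then show "class_map A \<in> carrier (weyl_group T)"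
        unfolding image using class_map_class by blast
    next
      fix A B assume "A \<in> carrier (coxeter_group n m)" "B \<in> carrier (coxeter_group n m)"
      then obtain u v where uv: "u \<in> words" "v \<in> words" "A = coxeter_class n m u" "B = coxeter_class n m v"
        unfolding carrier by blast
      then have "class_map (A \<otimes>\<^bsub>coxeter_group n m\<^esub> B) = word_map (u @ v)"
        by (simp add: mult_coxeter_class class_map_class)
      also have "\<dots> = class_map A \<otimes>\<^bsub>weyl_group T\<^esub> class_map B"
        using uv mult_BijGroup_foldr[OF map_a_lists map_a_lists, of u v]
        by (simp add: class_map_class word_map_def weyl_group_def subgroup_generated_def
            del: in_lists_conv_set)
      finally show "class_map (A \<otimes>\<^bsub>coxeter_group n m\<^esub> B) = class_map A \<otimes>\<^bsub>weyl_group T\<^esub> class_map B" .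
    qed
    show "bij_betw class_map (carrier (coxeter_group n m)) (carrier (weyl_group T))"
      unfolding bij_betw_def inj_on_def carrier image
      by (auto simp: class_map_class word_map_eq_iff coxeter_class_eq_iff image_image
          simp del: in_lists_conv_set)
  qed
qed

lemma is_coxeter_reflection_group:
  assumes "\<And>\<alpha>. \<alpha> \<in> T \<Longrightarrow> \<exists>u\<in>words. \<exists>i<n. \<alpha> = act u (a i)"
    and "inj_on a {..<n}" and "independent (a ` {..<n})" and "span (a ` {..<n}) = span T"
    and "\<And>i j. i < n \<Longrightarrow> j < n \<Longrightarrow> a i \<bullet> a j = - cos (pi / real (m i j))"
  shows "is_coxeter_reflection_group n m (span T) (weyl_group T)"
  unfolding is_coxeter_reflection_group_def
proof (intro exI conjI allI impI)
  show "class_map \<in> iso (coxeter_group n m) (weyl_group T)"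
    by (rule class_map_iso) (rule assms(1))
  show "class_map (coxeter_class n m [i]) = refl_on_span (span T) (a i)" if "i < n" for i
    using that by (simp add: class_map_class word_map_def refl_on_span_eq)
qed (use assms in auto)

end

section \<open>Conjugation in the golden integers\<close>

text \<open>A relation rather than a function, as closure under the ring operations is then immediate; that
  it is single-valued is the irrationality of \<open>sqrt 5\<close>. The conjugate of \<open>\<phi>\<close> is \<open>1 - \<phi>\<close>.\<close>

definition golden_conjugate :: "real \<Rightarrow> real \<Rightarrow> bool" where
  "golden_conjugate x x' \<longleftrightarrow>
     (\<exists>a b :: int. x = of_int a + of_int b * \<phi> \<and> x' = of_int a + of_int b * (1 - \<phi>))"

lemma golden_integer_has_conjugate:
  assumes "x \<in> \<int>[\<phi>]"
  shows "\<exists>x'. golden_conjugate x x'"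
proof -
  have "\<exists>a b :: int. poly (map_poly of_int p) \<phi> = of_int a + of_int b * \<phi>" for p :: "int poly"
  proof (induction p)
    case 0
    show ?case by (intro exI[of _ 0]) simp
  next
    case (pCons c p)
    then obtain a b :: int where ab: "poly (map_poly of_int p) \<phi> = of_int a + of_int b * \<phi>"
      by blast
    have "poly (map_poly of_int (pCons c p)) \<phi> = of_int (c + b) + of_int (a + b) * \<phi>"
      using ab by (simp add: map_poly_pCons algebra_simps golden_square golden_mult_mult)
    then show ?case by blast
  qed
  then show ?thesis
    using assms unfolding int_adjoin_def golden_conjugate_def by blast
qed

text \<open>The exponent of 5 is even on the left and odd on the right.\<close>

lemma five_not_square_ratio:
  fixes x y :: int
  assumes "x\<^sup>2 = 5 * y\<^sup>2"
  shows "y = 0"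
proof (rule ccontr)
  assume "y \<noteq> 0"
  then have "x \<noteq> 0" using assms by auto
  have p: "prime_elem (5 :: int)" by (intro prime_imp_prime_elem) simp
  have "multiplicity 5 (x\<^sup>2) = 2 * multiplicity 5 x"
    using p \<open>x \<noteq> 0\<close> by (simp add: prime_elem_multiplicity_power_distrib)
  moreover have "multiplicity 5 (5 * y\<^sup>2) = Suc (2 * multiplicity 5 y)"
    using p \<open>y \<noteq> 0\<close>
    by (simp add: prime_elem_multiplicity_mult_distrib prime_elem_multiplicity_power_distrib)
  ultimately have "2 * multiplicity 5 x = Suc (2 * multiplicity 5 y)" using assms by simp
  then show False by presburger
qed

lemma golden_conjugate_unique:
  assumes "golden_conjugate x x'" and "golden_conjugate x x''"
  shows "x' = x''"
proof -
  obtain a b :: int where x: "x = of_int a + of_int b * \<phi>" "x' = of_int a + of_int b * (1 - \<phi>)"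
    using assms(1) unfolding golden_conjugate_def by blast
  obtain c d :: int where y: "x = of_int c + of_int d * \<phi>" "x'' = of_int c + of_int d * (1 - \<phi>)"
    using assms(2) unfolding golden_conjugate_def by blast
  have "2 * of_int (a - c) + of_int (b - d) = of_int (d - b) * sqrt 5"
    using x(1) y(1) by (simp add: golden_def field_simps)
  then have "(2 * of_int (a - c) + of_int (b - d))\<^sup>2 = (of_int (d - b))\<^sup>2 * (5 :: real)"
    by (simp add: power_mult_distrib)
  then have "real_of_int ((2 * (a - c) + (b - d))\<^sup>2) = real_of_int (5 * (d - b)\<^sup>2)"
    by simp
  then have "(2 * (a - c) + (b - d))\<^sup>2 = 5 * (d - b)\<^sup>2"
    by (simp only: of_int_eq_iff)
  then have "d - b = 0" by (rule five_not_square_ratio)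
  then show ?thesis using x y by simp
qed

lemma golden_conjugate_of_int: "golden_conjugate (of_int k) (of_int k)"
  unfolding golden_conjugate_def by (intro exI[of _ k] exI[of _ 0]) simp

lemma golden_conjugate_diff:
  assumes "golden_conjugate x x'" and "golden_conjugate y y'"
  shows "golden_conjugate (x - y) (x' - y')"
proof -
  obtain a b :: int where "x = of_int a + of_int b * \<phi>" "x' = of_int a + of_int b * (1 - \<phi>)"
    using assms(1) unfolding golden_conjugate_def by blast
  moreover obtain c d :: int where "y = of_int c + of_int d * \<phi>" "y' = of_int c + of_int d * (1 - \<phi>)"
    using assms(2) unfolding golden_conjugate_def by blast
  ultimately show ?thesis unfolding golden_conjugate_def
    by (intro exI[of _ "a - c"] exI[of _ "b - d"]) (simp add: algebra_simps)
qed

lemma golden_conjugate_mult: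
  assumes "golden_conjugate x x'" and "golden_conjugate y y'"
  shows "golden_conjugate (x * y) (x' * y')"
proof -
  obtain a b :: int where x: "x = of_int a + of_int b * \<phi>" "x' = of_int a + of_int b * (1 - \<phi>)"
    using assms(1) unfolding golden_conjugate_def by blast
  obtain c d :: int where y: "y = of_int c + of_int d * \<phi>" "y' = of_int c + of_int d * (1 - \<phi>)"
    using assms(2) unfolding golden_conjugate_def by blast
  let ?A = "a * c + b * d" and ?B = "a * d + b * c + b * d"
  have "x * y = of_int ?A + of_int ?B * \<phi>" "x' * y' = of_int ?A + of_int ?B * (1 - \<phi>)"
    unfolding x y by (simp_all add: algebra_simps golden_square golden_mult_mult)
  then show ?thesis unfolding golden_conjugate_def by blast
qed

text \<open>Chebyshev polynomials of the second kind in \<open>t / 2\<close>, with the index shifted by one.\<close>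

fun chebyshev :: "real \<Rightarrow> nat \<Rightarrow> real" where
  "chebyshev t 0 = 0"
| "chebyshev t (Suc 0) = 1"
| "chebyshev t (Suc (Suc k)) = t * chebyshev t (Suc k) - chebyshev t k"

lemma golden_conjugate_chebyshev:
  "golden_conjugate t t' \<Longrightarrow> golden_conjugate (chebyshev t k) (chebyshev t' k)"
proof (induction t k rule: chebyshev.induct)
  case (1 t)
  show ?case using golden_conjugate_of_int[of 0] by simp
next
  case (2 t)
  show ?case using golden_conjugate_of_int[of 1] by simp
next
  case (3 t k)
  then show ?case by (simp add: golden_conjugate_diff golden_conjugate_mult)
qed

lemma chebyshev_strict_growth:
  assumes "2 < \<bar>t\<bar>"
  shows "\<bar>chebyshev t k\<bar> < \<bar>chebyshev t (Suc k)\<bar>"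
proof (induction k)
  case (Suc k)
  have "2 * \<bar>chebyshev t (Suc k)\<bar> \<le> \<bar>t\<bar> * \<bar>chebyshev t (Suc k)\<bar>"
    using assms by (intro mult_right_mono) auto
  also have "\<dots> = \<bar>t * chebyshev t (Suc k)\<bar>" by (simp add: abs_mult)
  also have "\<dots> \<le> \<bar>chebyshev t (Suc (Suc k))\<bar> + \<bar>chebyshev t k\<bar>" by simp
  finally show ?case using Suc by simp
qed simp

context root_system
begin

lemma abs_inner_less_one:
  assumes "\<alpha> \<in> T" "\<beta> \<in> T" "\<alpha> \<noteq> \<beta>" "\<alpha> \<noteq> - \<beta>"
  shows "\<bar>\<alpha> \<bullet> \<beta>\<bar> < 1"
proof -
  have "0 < (\<alpha> - \<beta>) \<bullet> (\<alpha> - \<beta>)" "0 < (\<alpha> + \<beta>) \<bullet> (\<alpha> + \<beta>)"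
    using assms by (simp_all add: add_eq_0_iff2)
  then show ?thesis
    using unit_root[OF assms(1)] unit_root[OF assms(2)]
    by (simp add: inner_diff_left inner_diff_right inner_add_left inner_add_right inner_commute)
qed

text \<open>Reflecting in \<open>\<beta>\<close> and then in \<open>\<alpha>\<close> advances both coefficients by two steps of the Chebyshev recursion.\<close>

lemma chebyshev_root:
  assumes "\<alpha> \<in> T" "\<beta> \<in> T" and t: "t = - 2 * (\<alpha> \<bullet> \<beta>)"
  shows "chebyshev t (Suc (2 * k)) *\<^sub>R \<alpha> + chebyshev t (2 * k) *\<^sub>R \<beta> \<in> T"
proof (induction k)
  case 0
  show ?case using assms by simp
next
  case (Suc k)
  have u: "\<alpha> \<bullet> \<alpha> = 1" "\<beta> \<bullet> \<beta> = 1" using assms unit_root by auto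
  have step_\<beta>: "reflection \<beta> (x *\<^sub>R \<alpha> + y *\<^sub>R \<beta>) = x *\<^sub>R \<alpha> + (t * x - y) *\<^sub>R \<beta>" for x y
    using u t by (simp add: reflection_unit inner_add_left algebra_simps flip: scaleR_2)
  have step_\<alpha>: "reflection \<alpha> (x *\<^sub>R \<alpha> + y *\<^sub>R \<beta>) = (t * y - x) *\<^sub>R \<alpha> + y *\<^sub>R \<beta>" for x y
    using u t by (simp add: reflection_unit inner_add_left inner_commute algebra_simps flip: scaleR_2)
  have "reflection \<alpha> (reflection \<beta>
      (chebyshev t (Suc (2 * k)) *\<^sub>R \<alpha> + chebyshev t (2 * k) *\<^sub>R \<beta>)) \<in> T"
    using Suc assms by (intro reflection_root)
  then show ?case unfolding step_\<alpha> step_\<beta> by simp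
qed

text \<open>The coordinates of the roots in the plane of \<open>\<alpha>\<close> and \<open>\<beta>\<close> take finitely many values, and conjugation
  carries the values at \<open>t\<close> to those at \<open>t'\<close>; but for \<open>\<bar>t'\<bar> > 2\<close> the latter are pairwise distinct.\<close>

lemma conjugate_bound:
  assumes "\<alpha> \<in> T" "\<beta> \<in> T" "\<alpha> \<noteq> \<beta>" "\<alpha> \<noteq> - \<beta>"
    and conj: "golden_conjugate (- 2 * (\<alpha> \<bullet> \<beta>)) t'"
  shows "\<bar>t'\<bar> \<le> 2"
proof (rule ccontr)
  assume "\<not> \<bar>t'\<bar> \<le> 2"
  then have "2 < \<bar>t'\<bar>" by simp
  define t where "t = - 2 * (\<alpha> \<bullet> \<beta>)"
  let ?g = "\<alpha> \<bullet> \<beta>"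
  \<comment> \<open>The coefficient of \<open>\<alpha>\<close> in a vector of the plane, by Cramer's rule.\<close>
  let ?coord = "\<lambda>v. (v \<bullet> \<alpha> - ?g * (v \<bullet> \<beta>)) / (1 - ?g * ?g)"
  have "\<bar>?g\<bar> * \<bar>?g\<bar> < 1 * 1"
    using abs_inner_less_one[OF assms(1-4)] by (intro mult_strict_mono) auto
  then have g: "1 - ?g * ?g \<noteq> 0" by simp
  have "chebyshev t (Suc (2 * k)) \<in> ?coord ` T" for k
  proof
    let ?v = "chebyshev t (Suc (2 * k)) *\<^sub>R \<alpha> + chebyshev t (2 * k) *\<^sub>R \<beta>"
    show "?v \<in> T" using chebyshev_root assms t_def by blast
    have "?v \<bullet> \<alpha> - ?g * (?v \<bullet> \<beta>) = chebyshev t (Suc (2 * k)) * (1 - ?g * ?g)"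
      using unit_root assms by (simp add: inner_add_left inner_commute algebra_simps)
    then show "chebyshev t (Suc (2 * k)) = ?coord ?v" using g by simp
  qed
  then have "range (\<lambda>k. chebyshev t (Suc (2 * k))) \<subseteq> ?coord ` T" by blast
  then have fin: "finite (range (\<lambda>k. chebyshev t (Suc (2 * k))))"
    using finite_roots finite_surj by blast
  let ?c = "\<lambda>x. THE x'. golden_conjugate x x'"
  have "?c (chebyshev t k) = chebyshev t' k" for k
    using golden_conjugate_chebyshev conj golden_conjugate_unique unfolding t_def by blast
  then have "range (\<lambda>k. chebyshev t' (Suc (2 * k))) = ?c ` range (\<lambda>k. chebyshev t (Suc (2 * k)))"
    by (simp add: image_image)
  then have "finite (range (\<lambda>k. chebyshev t' (Suc (2 * k))))" using fin by simp
  moreover have "strict_mono (\<lambda>k. \<bar>chebyshev t' k\<bar>)"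
    using chebyshev_strict_growth[OF \<open>2 < \<bar>t'\<bar>\<close>] by (simp add: strict_mono_Suc_iff)
  then have "inj (\<lambda>k. chebyshev t' (Suc (2 * k)))"
  proof (intro injI)
    fix k l assume "chebyshev t' (Suc (2 * k)) = chebyshev t' (Suc (2 * l))"
    then show "k = l"
      using strict_mono_eq[OF \<open>strict_mono _\<close>, of "Suc (2 * k)" "Suc (2 * l)"] by simp
  qed
  ultimately show False using finite_imageD infinite_UNIV_nat by blast
qed

end

lemma golden_bounds: "1.6 < \<phi>" "\<phi> < 1.7"
proof -
  have "2.2 < sqrt 5" by (rule real_less_rsqrt) (simp add: power2_eq_square)
  moreover have "sqrt 5 < 2.4" by (rule real_less_lsqrt) (simp_all add: power2_eq_square)
  ultimately show "1.6 < \<phi>" "\<phi> < 1.7" by (simp_all add: golden_def)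
qed

context simple_system
begin

text \<open>The conjugate bound confines \<open>t = x + y \<phi>\<close> and its conjugate, so \<open>y sqrt 5\<close>, their difference, is less than
  4 in absolute value and \<open>y\<close> is \<open>-1\<close>, \<open>0\<close> or \<open>1\<close>. The value \<open>\<phi> - 1\<close> belongs to the angle \<open>3 pi / 5\<close>, which occurs
  between roots but not between simple ones.\<close>

lemma simple_label:
  assumes "a \<in> \<Delta>" "b \<in> \<Delta>" "a \<noteq> b" and cartan: "cartan_coeff a b \<in> \<int>[\<phi>]"
  shows "- 2 * (a \<bullet> b) \<in> {0, 1, \<phi>}"
proof -
  define t where "t = - 2 * (a \<bullet> b)"
  have T: "a \<in> T" "b \<in> T" using assms simple_root by auto
  have ne: "a \<noteq> - b" using simple_pos[OF assms(1)] simple_pos[OF assms(2)] by auto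
  have range: "0 \<le> t" "t < 2"
    using simple_obtuse[OF assms(1-3)] abs_inner_less_one[OF T assms(3) ne] by (auto simp: t_def)
  obtain c where "golden_conjugate (2 * (a \<bullet> b)) c"
    using golden_integer_has_conjugate[OF cartan] unit_root[OF T(1)] by (auto simp: cartan_coeff_def)
  then have conj: "golden_conjugate t (- c)"
    using golden_conjugate_diff[OF golden_conjugate_of_int[of 0]] by (force simp: t_def)
  then obtain x y :: int where xy: "t = of_int x + of_int y * \<phi>" "- c = of_int x + of_int y * (1 - \<phi>)"
    unfolding golden_conjugate_def by blast
  have bound: "\<bar>of_int x + of_int y * (1 - \<phi>)\<bar> \<le> 2"
    using conjugate_bound[OF T assms(3) ne] conj xy(2) by (simp add: t_def)
  have "\<bar>of_int y * (2 * \<phi> - 1)\<bar> < 4"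
    using range bound xy(1) by (simp add: algebra_simps)
  then have "\<bar>of_int y\<bar> * (2 * \<phi> - 1) < 4" using golden_bounds by (simp add: abs_mult)
  moreover have "2 * 2.2 \<le> \<bar>of_int y\<bar> * (2 * \<phi> - 1)" if "2 \<le> \<bar>y\<bar>"
    using that golden_bounds by (intro mult_mono) auto
  ultimately have "\<bar>y\<bar> < 2" by fastforce
  then consider "y = 0" | "y = 1" | "y = - 1" by linarith
  then have "t \<in> {0, 1, \<phi>, \<phi> - 1}"
  proof cases
    case 1
    then have "x = 0 \<or> x = 1" using range xy by force
    then show ?thesis using 1 xy by auto
  next
    case 2
    then have "- 2 < real_of_int x" "real_of_int x < 1" using range xy golden_bounds by auto
    then have "x = - 1 \<or> x = 0" by linarith
    then show ?thesis using 2 xy by auto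
  next
    case 3
    then have "1 < real_of_int x" using range xy golden_bounds by auto
    then have "2 \<le> x" by simp
    then show ?thesis using 3 bound golden_bounds by auto
  qed
  moreover have "t \<noteq> \<phi> - 1"
  proof
    assume t: "t = \<phi> - 1"
    have "reflection b (reflection a b) = t *\<^sub>R a + (t * t - 1) *\<^sub>R b"
      using unit_root T
      by (simp add: reflection_unit t_def inner_diff_left inner_commute algebra_simps flip: scaleR_2)
    also have "t * t - 1 = - t" unfolding t by (simp add: algebra_simps golden_square)
    finally have "t *\<^sub>R a - t *\<^sub>R b \<in> T" using reflection_root T by (metis scaleR_minus_left uminus_add_conv_diff add.commute)
    then show False using no_mixed_root[OF assms(1-3), of t t] t golden_bounds by simp
  qed
  ultimately show ?thesis by (auto simp: t_def)
qed

text \<open>Integrality passes along the reflections to one argument of the form, and by invariance of the form to the other.\<close>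

lemma crystallographic_if_simple_integral:
  assumes "\<And>a b. a \<in> \<Delta> \<Longrightarrow> b \<in> \<Delta> \<Longrightarrow> 2 * (a \<bullet> b) \<in> \<int>"
  shows "crystallographic T"
proof -
  have simple: "2 * (\<alpha> \<bullet> b) \<in> \<int>" if \<alpha>: "\<alpha> \<in> T" and b: "b \<in> \<Delta>" for \<alpha> b
  proof -
    obtain xs a where xs: "xs \<in> lists \<Delta>" "a \<in> \<Delta>" "\<alpha> = foldr reflection xs a"
      using \<alpha> by (rule root_orbit)
    have "\<forall>b\<in>\<Delta>. 2 * (foldr reflection xs a \<bullet> b) \<in> \<int>"
      using xs(1)
    proof (induction xs)
      case Nil
      then show ?case using assms xs(2) by simp
    next
      case (Cons x xs)
      show ?case
      proof
        fix b assume "b \<in> \<Delta>"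
        let ?v = "foldr reflection xs a"
        have eq: "2 * (foldr reflection (x # xs) a \<bullet> b) = 2 * (?v \<bullet> b) - (2 * (?v \<bullet> x)) * (2 * (x \<bullet> b))"
          using Cons.hyps simple_root by (simp add: reflection_unit unit_root inner_diff_left)
        show "2 * (foldr reflection (x # xs) a \<bullet> b) \<in> \<int>"
          unfolding eq using Cons \<open>b \<in> \<Delta>\<close> assms
          by (intro Ints_diff[OF _ Ints_mult[of "2 * (?v \<bullet> x)" "2 * (x \<bullet> b)"]]) blast+
      qed
    qed
    then show ?thesis using xs b by simp
  qed
  have "2 * (\<alpha> \<bullet> \<beta>) \<in> \<int>" if \<alpha>: "\<alpha> \<in> T" and \<beta>: "\<beta> \<in> T" for \<alpha> \<beta>
  proof -
    obtain xs b where xs: "xs \<in> lists \<Delta>" "b \<in> \<Delta>" "\<beta> = foldr reflection xs b"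
      using \<beta> by (rule root_orbit)
    have "foldr reflection (rev xs) \<alpha> \<in> T"
      using foldr_reflection_root \<alpha> xs(1) simple_root by (simp add: in_lists_conv_set)
    moreover have "\<alpha> \<bullet> \<beta> = foldr reflection (rev xs) \<alpha> \<bullet> b"
      using inner_foldr_reflection[of "rev xs" \<alpha> \<beta>] xs(3) by simp
    ultimately show ?thesis using simple xs(2) by simp
  qed
  then show ?thesis by (simp add: crystallographic_def cartan_coeff_def unit_root)
qed

text \<open>If \<open>S\<close> is orthogonal to the other simple roots, then the reflections in \<open>\<Delta>\<close> preserve the span of \<open>S\<close> and that
  of \<open>\<Delta> - S\<close>, so every root lies in one of the two.\<close>

lemma diagram_connected:
  assumes "indecomposable T" and "S \<subseteq> \<Delta>" and "S \<noteq> {}" and "S \<noteq> \<Delta>"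
  obtains s b where "s \<in> S" "b \<in> \<Delta> - S" "s \<bullet> b \<noteq> 0"
proof (rule ccontr)
  assume "\<not> thesis"
  then have "\<forall>s\<in>S. \<forall>b\<in>\<Delta> - S. s \<bullet> b = 0" using that by blast
  then have orth: "s \<bullet> b = 0" if "s \<in> S" "b \<in> \<Delta> - S" for s b
    using that by blast
  have stay: "foldr reflection xs a \<in> span S'"
    if perp: "\<And>s b. s \<in> S' \<Longrightarrow> b \<in> \<Delta> - S' \<Longrightarrow> s \<bullet> b = 0" and xs: "xs \<in> lists \<Delta>" and a: "a \<in> S'"
    for S' xs a
    using xs
  proof (induction xs)
    case Nil
    then show ?case using a by (simp add: span_base)
  next
    case (Cons x xs)
    let ?v = "foldr reflection xs a"
    show ?case
    proof (cases "x \<in> S'")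
      case True
      then show ?thesis
        using Cons by (auto simp: reflection_def intro: span_diff span_scale span_base)
    next
      case False
      then have "orthogonal x s" if "s \<in> S'" for s
        using perp[OF that, of x] Cons.hyps(1) \<open>x \<notin> S'\<close> by (simp add: orthogonal_def inner_commute)
      then have "orthogonal x ?v"
        using orthogonal_to_span Cons.IH by blast
      then have "reflection x ?v = ?v"
        by (simp add: reflection_def[of x ?v] orthogonal_def inner_commute)
      then show ?thesis using Cons by simp
    qed
  qed
  define A where "A = T \<inter> span S"
  define B where "B = T \<inter> span (\<Delta> - S)"
  have "T \<subseteq> A \<union> B"
  proof
    fix \<alpha> assume \<alpha>: "\<alpha> \<in> T"
    then obtain xs a where xs: "xs \<in> lists \<Delta>" "a \<in> \<Delta>" "\<alpha> = foldr reflection xs a"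
      by (rule root_orbit)
    show "\<alpha> \<in> A \<union> B"
    proof (cases "a \<in> S")
      case True
      then have "foldr reflection xs a \<in> span S"
        using orth xs(1) by (intro stay)
      then show ?thesis using xs \<alpha> by (simp add: A_def)
    next
      case False
      have "s \<bullet> b = 0" if "s \<in> \<Delta> - S" "b \<in> \<Delta> - (\<Delta> - S)" for s b
        using orth[of b s] that by (simp add: inner_commute)
      then have "foldr reflection xs a \<in> span (\<Delta> - S)"
        using xs False by (intro stay) auto
      then show ?thesis using xs \<alpha> by (simp add: B_def)
    qed
  qed
  then have "T = A \<union> B" by (auto simp: A_def B_def)
  moreover obtain s b where "s \<in> S" "b \<in> \<Delta> - S" using assms(2-4) by blast
  then have "s \<in> A" "b \<in> B"
    using assms(2) simple_root span_base[of s S] span_base[of b "\<Delta> - S"]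
    by (auto simp: A_def B_def)
  then have "A \<noteq> {}" "B \<noteq> {}" by auto
  moreover have "orthogonal x y" if "x \<in> A" "y \<in> B" for x y
  proof -
    have "orthogonal s y" if "s \<in> S" for s
      using that \<open>y \<in> B\<close> orth by (intro orthogonal_to_span[of y "\<Delta> - S"]) (auto simp: B_def orthogonal_def)
    then have "orthogonal y x"
      using \<open>x \<in> A\<close> by (intro orthogonal_to_span[of x S]) (auto simp: A_def orthogonal_commute)
    then show ?thesis by (simp add: orthogonal_commute)
  qed
  ultimately show False using assms(1) unfolding indecomposable_def by blast
qed

end

section \<open>Diagrams containing an edge labelled 5\<close>

text \<open>The triple and the double of \<open>pi / 5\<close> add up to \<open>pi\<close>, so their cosines are opposite; this is a cubic equation for
  \<open>cos (pi / 5)\<close> with the factor \<open>cos (pi / 5) + 1\<close>.\<close>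

lemma cos_pi_fifth: "cos (pi / 5) = \<phi> / 2"
proof -
  let ?c = "cos (pi / 5)"
  have pos: "0 < ?c" by (intro cos_gt_zero) (auto simp: field_simps)
  have "3 * (pi / 5) = pi - 2 * (pi / 5)" by (simp add: field_simps)
  then have "cos (3 * (pi / 5)) = cos (pi - 2 * (pi / 5))" by (rule arg_cong)
  also have "\<dots> = - cos (2 * (pi / 5))" by (rule cos_pi_minus)
  finally have "4 * ?c ^ 3 - 3 * ?c = 1 - 2 * ?c\<^sup>2"
    by (simp only: cos_treble_cos cos_double_cos)
  then have "(?c + 1) * (4 * ?c\<^sup>2 - 2 * ?c - 1) = 0"
    by (simp add: algebra_simps power2_eq_square power3_eq_cube)
  then have "4 * ?c\<^sup>2 - 2 * ?c - 1 = 0" using pos by simp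
  moreover have "4 * ?c\<^sup>2 - 2 * ?c - 1 = (2 * ?c - \<phi>) * (2 * ?c + \<phi> - 1)"
    by (simp add: algebra_simps power2_eq_square golden_square)
  ultimately show ?thesis using pos golden_bounds by simp
qed

lemma dihedral_label_H_matrix:
  "i \<noteq> j \<Longrightarrow> dihedral_label (H_matrix i j) (2 * cos (pi / real (H_matrix i j)))"
  using dihedral_label.intros by (simp add: H_matrix_def cos_pi_fifth cos_60)

definition H_gram :: "nat \<Rightarrow> nat \<Rightarrow> real" where
  "H_gram i j = - cos (pi / real (H_matrix i j))"

lemma H_gram_commute: "H_gram i j = H_gram j i"
  by (simp add: H_gram_def H_matrix_def insert_commute disj_commute)

lemma H_gram_diag: "H_gram i i = 1"
  by (simp add: H_gram_def H_matrix_def)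

lemma H_gram_values:
  "H_gram 0 (Suc 0) = - \<phi> / 2" "H_gram 0 (Suc (Suc 0)) = 0" "H_gram 0 (Suc (Suc (Suc 0))) = 0"
  "H_gram (Suc 0) 0 = - \<phi> / 2" "H_gram (Suc 0) (Suc (Suc 0)) = - 1 / 2" "H_gram (Suc 0) (Suc (Suc (Suc 0))) = 0"
  "H_gram (Suc (Suc 0)) 0 = 0" "H_gram (Suc (Suc 0)) (Suc 0) = - 1 / 2" "H_gram (Suc (Suc 0)) (Suc (Suc (Suc 0))) = - 1 / 2"
  "H_gram (Suc (Suc (Suc 0))) 0 = 0" "H_gram (Suc (Suc (Suc 0))) (Suc 0) = 0" "H_gram (Suc (Suc (Suc 0))) (Suc (Suc 0)) = - 1 / 2"
  by (simp_all add: H_gram_def H_matrix_def cos_pi_fifth cos_60 doubleton_eq_iff)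

text \<open>The square of \<open>b + \<Sum> k\<^sub>i a\<^sub>i\<close>. If a new node \<open>b\<close> is attached too strongly to the nodes \<open>a\<^sub>i\<close>, suitable \<open>k\<close> make
  the right-hand side negative.\<close>

lemma square_expansion:
  fixes a :: "nat \<Rightarrow> 'a::real_inner"
  assumes "b \<bullet> b = 1" and "\<And>i j. i < n \<Longrightarrow> j < n \<Longrightarrow> a i \<bullet> a j = g i j"
  shows "0 \<le> 1 + (\<Sum>i<n. \<Sum>j<n. k i * (k j * g i j)) + (\<Sum>i<n. k i * (2 * (a i \<bullet> b)))"
proof -
  let ?v = "\<Sum>i<n. k i *\<^sub>R a i"
  have "?v \<bullet> ?v = (\<Sum>i<n. k i * (a i \<bullet> ?v))"
    by (simp only: inner_sum_left inner_scaleR_left)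
  also have "\<dots> = (\<Sum>i<n. k i * (\<Sum>j<n. k j * (a i \<bullet> a j)))"
    by (simp only: inner_sum_right inner_scaleR_right)
  also have "\<dots> = (\<Sum>i<n. \<Sum>j<n. k i * (k j * g i j))"
    using assms(2) by (simp add: sum_distrib_left)
  finally have "?v \<bullet> ?v = (\<Sum>i<n. \<Sum>j<n. k i * (k j * g i j))" .
  moreover have "2 * (?v \<bullet> b) = (\<Sum>i<n. k i * (2 * (a i \<bullet> b)))"
    by (simp add: inner_sum_left sum_distrib_left mult.left_commute)
  moreover have "(b + ?v) \<bullet> (b + ?v) = 1 + ?v \<bullet> ?v + 2 * (?v \<bullet> b)"
    using assms(1) inner_commute[of b ?v] by (simp only: inner_add_left inner_add_right)
  moreover have "0 \<le> (b + ?v) \<bullet> (b + ?v)" by simp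
  ultimately show ?thesis by simp
qed

context simple_system
begin

text \<open>The order of the list matters: the edge labelled 5 joins its first two members.\<close>

definition H_chain :: "'a list \<Rightarrow> bool" where
  "H_chain xs \<longleftrightarrow> distinct xs \<and> set xs \<subseteq> \<Delta> \<and>
     (\<forall>i<length xs. \<forall>j<length xs. xs ! i \<bullet> xs ! j = H_gram i j)"

lemma H_chain_snoc:
  assumes "H_chain xs" and "b \<in> \<Delta>" and "b \<notin> set xs"
    and "\<And>i. i < length xs \<Longrightarrow> xs ! i \<bullet> b = H_gram i (length xs)"
  shows "H_chain (xs @ [b])"
proof -
  have "(xs @ [b]) ! i \<bullet> (xs @ [b]) ! j = H_gram i j" if "i \<le> length xs" "j \<le> length xs" for i j
  proof -
    consider "i < length xs" "j < length xs" | "i < length xs" "j = length xs"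
      | "i = length xs" "j < length xs" | "i = length xs" "j = length xs"
      using \<open>i \<le> length xs\<close> \<open>j \<le> length xs\<close> by linarith
    then show ?thesis
    proof cases
      case 1
      then show ?thesis using assms(1) by (simp add: H_chain_def nth_append)
    next
      case 2
      then show ?thesis using assms(4)[of i] by (simp add: nth_append)
    next
      case 3
      then show ?thesis
        using assms(4)[of j] inner_commute[of b "xs ! j"] H_gram_commute[of i j]
        by (simp add: nth_append)
    next
      case 4
      then show ?thesis using unit_root[OF simple_root[OF assms(2)]] by (simp add: H_gram_diag)
    qed
  qed
  moreover have "distinct (xs @ [b])" "set (xs @ [b]) \<subseteq> \<Delta>"
    using assms by (auto simp: H_chain_def)
  ultimately show ?thesis by (simp add: H_chain_def less_Suc_eq_le)
qed

lemma H_chain_test: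
  assumes "H_chain xs" and "b \<in> \<Delta>" and "length xs = n"
  shows "0 \<le> 1 + (\<Sum>i<n. \<Sum>j<n. k ! i * (k ! j * H_gram i j)) + (\<Sum>i<n. k ! i * (2 * (xs ! i \<bullet> b)))"
  using assms unit_root[OF simple_root[OF assms(2)]]
  by (intro square_expansion) (auto simp: H_chain_def)

lemma H_chain_2_test:
  assumes "H_chain [a0, a1]" and "b \<in> \<Delta>"
  shows "0 \<le> 1 + k0 * k0 + k1 * k1 - \<phi> * (k0 * k1) + k0 * (2 * (a0 \<bullet> b)) + k1 * (2 * (a1 \<bullet> b))"
  using H_chain_test[OF assms, of 2 "[k0, k1]"]
  by (simp add: eval_nat_numeral H_gram_values H_gram_diag algebra_simps)

lemma H_chain_3_test:
  assumes "H_chain [a0, a1, a2]" and "b \<in> \<Delta>"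
  shows "0 \<le> 1 + k0 * k0 + k1 * k1 + k2 * k2 - \<phi> * (k0 * k1) - k1 * k2
    + k0 * (2 * (a0 \<bullet> b)) + k1 * (2 * (a1 \<bullet> b)) + k2 * (2 * (a2 \<bullet> b))"
  using H_chain_test[OF assms, of 3 "[k0, k1, k2]"]
  by (simp add: eval_nat_numeral H_gram_values H_gram_diag algebra_simps)

lemma H_chain_4_test:
  assumes "H_chain [a0, a1, a2, a3]" and "b \<in> \<Delta>"
  shows "0 \<le> 1 + k0 * k0 + k1 * k1 + k2 * k2 + k3 * k3 - \<phi> * (k0 * k1) - k1 * k2 - k2 * k3
    + k0 * (2 * (a0 \<bullet> b)) + k1 * (2 * (a1 \<bullet> b)) + k2 * (2 * (a2 \<bullet> b)) + k3 * (2 * (a3 \<bullet> b))"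
  using H_chain_test[OF assms, of 4 "[k0, k1, k2, k3]"]
  by (simp add: eval_nat_numeral H_gram_values H_gram_diag algebra_simps)

lemma H_chain_pair:
  assumes "a0 \<in> \<Delta>" "a1 \<in> \<Delta>" "a0 \<noteq> a1" and "- 2 * (a0 \<bullet> a1) = \<phi>"
  shows "H_chain [a0, a1]"
proof -
  have "H_chain [a0]"
    using assms unit_root[OF simple_root] by (simp add: H_chain_def H_gram_diag)
  then have "H_chain ([a0] @ [a1])"
    using assms by (intro H_chain_snoc) (auto simp: H_gram_values)
  then show ?thesis by simp
qed

text \<open>The square is least in the direction of the column of the inverse Gram matrix that belongs to the node
  to which \<open>b\<close> is attached, or of a sum of such columns; the coefficients here and in
  the next two lemmas are found in this way. Here \<open>(1, 1)\<close> excludes a triangle, and \<open>(2, \<phi>)\<close>, \<open>(\<phi>, 2)\<close> exclude a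
  second edge labelled 5. The two ends of the edge are symmetric, hence the two outcomes.\<close>

lemma H_chain_extend_2:
  assumes chain: "H_chain [a0, a1]" and b: "b \<in> \<Delta>" "b \<notin> {a0, a1}"
    and labels: "- 2 * (a0 \<bullet> b) \<in> {0, 1, \<phi>}" "- 2 * (a1 \<bullet> b) \<in> {0, 1, \<phi>}"
    and "a0 \<bullet> b \<noteq> 0 \<or> a1 \<bullet> b \<noteq> 0"
  shows "H_chain [a0, a1, b] \<or> H_chain [a1, a0, b]"
proof -
  define c0 c1 where "c0 = - 2 * (a0 \<bullet> b)" and "c1 = - 2 * (a1 \<bullet> b)"
  have inner: "a0 \<bullet> b = - c0 / 2" "a1 \<bullet> b = - c1 / 2" by (simp_all add: c0_def c1_def)
  have c: "c0 \<in> {0, 1, \<phi>}" "c1 \<in> {0, 1, \<phi>}" "c0 \<noteq> 0 \<or> c1 \<noteq> 0"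
    using labels assms(6) by (auto simp: c0_def c1_def)
  have nonneg: "0 \<le> c0" "0 \<le> c1" using c golden_bounds by auto
  have "c0 + c1 \<le> 3 - \<phi>"
    using H_chain_2_test[OF chain b(1), of 1 1] inner by simp
  moreover have "2 * c0 + \<phi> * c1 \<le> 4 - \<phi>"
    using H_chain_2_test[OF chain b(1), of 2 \<phi>] inner by (simp add: golden_square golden_mult_mult algebra_simps)
  moreover have "\<phi> * c0 + 2 * c1 \<le> 4 - \<phi>"
    using H_chain_2_test[OF chain b(1), of \<phi> 2] inner by (simp add: golden_square golden_mult_mult algebra_simps)
  moreover have "0 \<le> \<phi> * c0" "0 \<le> \<phi> * c1"
    using nonneg golden_pos by simp_all
  ultimately have "c0 = 0 \<and> c1 = 1 \<or> c0 = 1 \<and> c1 = 0"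
    using c golden_bounds by auto
  then show ?thesis
  proof (elim disjE conjE)
    assume "c0 = 0" "c1 = 1"
    then have "H_chain ([a0, a1] @ [b])"
      using chain b inner by (intro H_chain_snoc) (auto simp: H_gram_values less_Suc_eq numeral_2_eq_2)
    then show ?thesis by simp
  next
    assume "c0 = 1" "c1 = 0"
    have "H_chain [a1, a0]"
    proof (rule H_chain_pair)
      have "a0 \<bullet> a1 = H_gram 0 1" using chain by (force simp: H_chain_def)
      then show "- 2 * (a1 \<bullet> a0) = \<phi>" by (simp add: H_gram_values inner_commute)
    qed (use chain in \<open>auto simp: H_chain_def\<close>)
    then have "H_chain ([a1, a0] @ [b])"
      using b inner \<open>c0 = 1\<close> \<open>c1 = 0\<close>
      by (intro H_chain_snoc) (auto simp: H_gram_values less_Suc_eq numeral_2_eq_2)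
    then show ?thesis by simp
  qed
qed

text \<open>The coefficients \<open>(3, 2 \<phi>, \<phi>)\<close> exclude any edge to \<open>a\<^sub>0\<close> or \<open>a\<^sub>1\<close>, the other ones an edge labelled 5 to \<open>a\<^sub>2\<close>.\<close>

lemma H_chain_extend_3:
  assumes chain: "H_chain [a0, a1, a2]" and b: "b \<in> \<Delta>" "b \<notin> {a0, a1, a2}"
    and labels: "- 2 * (a0 \<bullet> b) \<in> {0, 1, \<phi>}" "- 2 * (a1 \<bullet> b) \<in> {0, 1, \<phi>}" "- 2 * (a2 \<bullet> b) \<in> {0, 1, \<phi>}"
    and "a0 \<bullet> b \<noteq> 0 \<or> a1 \<bullet> b \<noteq> 0 \<or> a2 \<bullet> b \<noteq> 0"
  shows "H_chain [a0, a1, a2, b]"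
proof -
  define c0 c1 c2 where "c0 = - 2 * (a0 \<bullet> b)" and "c1 = - 2 * (a1 \<bullet> b)" and "c2 = - 2 * (a2 \<bullet> b)"
  have inner: "a0 \<bullet> b = - c0 / 2" "a1 \<bullet> b = - c1 / 2" "a2 \<bullet> b = - c2 / 2"
    by (simp_all add: c0_def c1_def c2_def)
  have c: "c0 \<in> {0, 1, \<phi>}" "c1 \<in> {0, 1, \<phi>}" "c2 \<in> {0, 1, \<phi>}" "c0 \<noteq> 0 \<or> c1 \<noteq> 0 \<or> c2 \<noteq> 0"
    using labels assms(7) by (auto simp: c0_def c1_def c2_def)
  have nonneg: "0 \<le> c0" "0 \<le> c1" "0 \<le> c2" using c golden_bounds by auto
  then have pos: "0 \<le> \<phi> * c0" "0 \<le> \<phi> * c1" "0 \<le> \<phi> * c2" using golden_pos by simp_all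
  have "3 * c0 + 2 * (\<phi> * c1) + \<phi> * c2 \<le> 7 - 3 * \<phi>"
    using H_chain_3_test[OF chain b(1), of 3 "2 * \<phi>" \<phi>] inner
    by (simp add: golden_square golden_mult_mult algebra_simps)
  then have "c0 < 1" "\<phi> * c1 < \<phi>" using pos nonneg golden_bounds by linarith+
  then have 01: "c0 = 0" "c1 = 0" using c golden_bounds by auto
  have "10 * c2 \<le> 19 - 5 * \<phi>"
    using H_chain_3_test[OF chain b(1), of "(3 * \<phi> + 1) / 2" "2 + \<phi>" "5 / 2"] inner 01
    by (simp add: golden_square golden_mult_mult field_simps)
  then have "c2 = 1" using c 01 golden_bounds by auto
  then have "H_chain ([a0, a1, a2] @ [b])"
    using chain b inner 01
    by (intro H_chain_snoc) (auto simp: H_gram_values less_Suc_eq numeral_2_eq_2 numeral_3_eq_3)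
  then show ?thesis by simp
qed

text \<open>All coefficients of the test vector are at least 2, while the Gram form takes the value \<open>2 - \<phi>\<close> on it, so it excludes an edge to
  any of the four nodes.\<close>

lemma H_chain_extend_4:
  assumes chain: "H_chain [a0, a1, a2, a3]" and b: "b \<in> \<Delta>"
    and labels: "- 2 * (a0 \<bullet> b) \<in> {0, 1, \<phi>}" "- 2 * (a1 \<bullet> b) \<in> {0, 1, \<phi>}"
      "- 2 * (a2 \<bullet> b) \<in> {0, 1, \<phi>}" "- 2 * (a3 \<bullet> b) \<in> {0, 1, \<phi>}"
  shows "a0 \<bullet> b = 0 \<and> a1 \<bullet> b = 0 \<and> a2 \<bullet> b = 0 \<and> a3 \<bullet> b = 0"
proof -
  define c0 c1 c2 c3 where "c0 = - 2 * (a0 \<bullet> b)" and "c1 = - 2 * (a1 \<bullet> b)"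
    and "c2 = - 2 * (a2 \<bullet> b)" and "c3 = - 2 * (a3 \<bullet> b)"
  have inner: "a0 \<bullet> b = - c0 / 2" "a1 \<bullet> b = - c1 / 2" "a2 \<bullet> b = - c2 / 2" "a3 \<bullet> b = - c3 / 2"
    by (simp_all add: c0_def c1_def c2_def c3_def)
  have c: "c0 \<in> {0, 1, \<phi>}" "c1 \<in> {0, 1, \<phi>}" "c2 \<in> {0, 1, \<phi>}" "c3 \<in> {0, 1, \<phi>}"
    using labels by (auto simp: c0_def c1_def c2_def c3_def)
  have nonneg: "0 \<le> c0" "0 \<le> c1" "0 \<le> c2" "0 \<le> c3" using c golden_bounds by auto
  then have pos: "0 \<le> \<phi> * c0" "0 \<le> \<phi> * c1" "0 \<le> \<phi> * c2" using golden_pos by simp_all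
  have "(2 * (\<phi> * c0) + c0) + (2 * c1 + 2 * (\<phi> * c1)) + (2 * c2 + \<phi> * c2) + 2 * c3 \<le> 3 - \<phi>"
    using H_chain_4_test[OF chain b, of "2 * \<phi> + 1" "2 + 2 * \<phi>" "2 + \<phi>" 2] inner
    by (simp add: golden_square golden_mult_mult algebra_simps)
  then have "\<phi> * c0 < \<phi>" "c1 < 1" "c2 < 1" "c3 < 1" using pos nonneg golden_bounds by linarith+
  then have "c0 = 0" "c1 = 0" "c2 = 0" "c3 = 0" using c golden_bounds by auto
  then show ?thesis using inner by simp
qed

text \<open>Grow the diagram from an edge labelled 5 until it exhausts \<open>\<Delta>\<close>; connectedness supplies an adjacent node as long
  as it does not.\<close>

lemma simple_roots_form_H_chain:
  assumes "indecomposable T" and "\<not> crystallographic T"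
    and cartan: "\<And>a b. a \<in> \<Delta> \<Longrightarrow> b \<in> \<Delta> \<Longrightarrow> cartan_coeff a b \<in> \<int>[\<phi>]"
  obtains xs where "H_chain xs" "set xs = \<Delta>" "length xs \<in> {2, 3, 4}"
proof -
  have labels: "- 2 * (a \<bullet> b) \<in> {0, 1, \<phi>}" if "a \<in> \<Delta>" "b \<in> \<Delta>" "a \<noteq> b" for a b
    using that cartan by (intro simple_label)
  have "\<exists>a\<in>\<Delta>. \<exists>b\<in>\<Delta>. a \<noteq> b \<and> - 2 * (a \<bullet> b) = \<phi>"
  proof (rule ccontr)
    assume no: "\<not> ?thesis"
    have "2 * (a \<bullet> b) \<in> \<int>" if "a \<in> \<Delta>" "b \<in> \<Delta>" for a b
    proof (cases "a = b")
      case True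
      then show ?thesis using that simple_root unit_root by simp
    next
      case False
      then have "- 2 * (a \<bullet> b) = 0 \<or> - 2 * (a \<bullet> b) = 1" using no labels that by blast
      then have "2 * (a \<bullet> b) = 0 \<or> 2 * (a \<bullet> b) = - 1" by auto
      then show ?thesis by auto
    qed
    then show False using crystallographic_if_simple_integral assms(2) by blast
  qed
  then obtain a0 a1 where 2: "H_chain [a0, a1]" using H_chain_pair by blast
  have sub: "set xs \<subseteq> \<Delta>" if "H_chain xs" for xs using that by (simp add: H_chain_def)
  have grow: "\<exists>b\<in>\<Delta>. b \<notin> set xs \<and> (\<exists>s\<in>set xs. s \<bullet> b \<noteq> 0) \<and> (\<forall>s\<in>set xs. - 2 * (s \<bullet> b) \<in> {0, 1, \<phi>})"
    if chain: "H_chain xs" and ne: "xs \<noteq> []" "set xs \<noteq> \<Delta>" for xs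
  proof -
    obtain s b where sb: "s \<in> set xs" "b \<in> \<Delta> - set xs" "s \<bullet> b \<noteq> 0"
      using diagram_connected[OF assms(1) sub[OF chain]] ne by auto
    moreover have "- 2 * (s \<bullet> b) \<in> {0, 1, \<phi>}" if "s \<in> set xs" for s
      using labels[of s b] sub[OF chain] that sb(2) by blast
    ultimately show ?thesis by blast
  qed
  show ?thesis
  proof (cases "set [a0, a1] = \<Delta>")
    case True
    then show ?thesis using 2 that by force
  next
    case False
    obtain b where "b \<in> \<Delta>" "b \<notin> set [a0, a1]" "\<exists>s\<in>set [a0, a1]. s \<bullet> b \<noteq> 0"
      "\<forall>s\<in>set [a0, a1]. - 2 * (s \<bullet> b) \<in> {0, 1, \<phi>}"
      using grow[OF 2 _ False] by blast
    then have "H_chain [a0, a1, b] \<or> H_chain [a1, a0, b]"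
      by (intro H_chain_extend_2[OF 2]) simp_all
    then obtain d0 d1 d2 where 3: "H_chain [d0, d1, d2]" by blast
    show ?thesis
    proof (cases "set [d0, d1, d2] = \<Delta>")
      case True
      then show ?thesis using 3 that by force
    next
      case False
      obtain e where "e \<in> \<Delta>" "e \<notin> set [d0, d1, d2]" "\<exists>s\<in>set [d0, d1, d2]. s \<bullet> e \<noteq> 0"
        "\<forall>s\<in>set [d0, d1, d2]. - 2 * (s \<bullet> e) \<in> {0, 1, \<phi>}"
        using grow[OF 3 _ False] by blast
      then have 4: "H_chain [d0, d1, d2, e]"
        by (intro H_chain_extend_3[OF 3]) simp_all
      have "set [d0, d1, d2, e] = \<Delta>"
      proof (rule ccontr)
        assume no: "set [d0, d1, d2, e] \<noteq> \<Delta>"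
        obtain f where "f \<in> \<Delta>" "\<exists>s\<in>set [d0, d1, d2, e]. s \<bullet> f \<noteq> 0"
          "\<forall>s\<in>set [d0, d1, d2, e]. - 2 * (s \<bullet> f) \<in> {0, 1, \<phi>}"
          using grow[OF 4 _ no] by blast
        then show False using H_chain_extend_4[OF 4, of f] by simp
      qed
      then show ?thesis using 4 that by force
    qed
  qed
qed

lemma is_H_of_chain:
  assumes "\<rho> \<in> span T" and chain: "H_chain xs" and set: "set xs = \<Delta>"
  shows "is_H (length xs) (span T) (weyl_group T)"
proof -
  let ?a = "(!) xs" and ?n = "length xs"
  have image: "?a ` {..<?n} = \<Delta>"
    using set by (auto simp: set_conv_nth)
  interpret coxeter_roots T \<rho> ?n ?a H_matrix
  proof
    show "dihedral_label (H_matrix i j) (- 2 * (xs ! i \<bullet> xs ! j))"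
      if "i < ?n" "j < ?n" "i \<noteq> j" for i j
      using dihedral_label_H_matrix[OF that(3)] chain that by (simp add: H_chain_def H_gram_def)
  qed (use assms(1) regular simple_root simple_pos set in \<open>auto simp: H_matrix_def\<close>)
  show ?thesis
    unfolding is_H_def
  proof (rule is_coxeter_reflection_group)
    fix \<alpha> assume "\<alpha> \<in> T"
    then obtain ys b where ys: "ys \<in> lists \<Delta>" "b \<in> \<Delta>" "\<alpha> = foldr reflection ys b"
      by (rule root_orbit)
    have "ys \<in> lists (?a ` {..<?n})" using ys(1) image by simp
    then have "ys \<in> map ?a ` lists {..<?n}" unfolding lists_image .
    moreover have "b \<in> ?a ` {..<?n}" using ys(2) image by simp
    ultimately show "\<exists>u\<in>lists {..<?n}. \<exists>i<?n. \<alpha> = foldr reflection (map ?a u) (?a i)"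
      using ys(3) by blast
  next
    show "inj_on ?a {..<?n}" using chain by (intro inj_on_nth) (auto simp: H_chain_def)
  qed (use chain in \<open>simp_all add: image independent_simple span_simple H_chain_def H_gram_def\<close>)
qed

end

theorem theorem6p1:
  fixes T :: "'a::euclidean_space set"
  assumes "root_shell_system \<int>[\<phi>] T"
    and "indecomposable T"
    and "\<not> crystallographic T"
  shows "rank_of T \<in> {2, 3, 4} \<and>
    (is_H 2 (span T) (weyl_group T) \<or>
     is_H 3 (span T) (weyl_group T) \<or>
     is_H 4 (span T) (weyl_group T))"
proof -
  interpret root_system T
  proof
    show "reflection \<alpha> \<beta> \<in> T" if "\<alpha> \<in> T" "\<beta> \<in> T" for \<alpha> \<beta>
      using assms(1) that unfolding root_shell_system_def by blast
  qed (use assms(1) in \<open>simp_all add: root_shell_system_def\<close>)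
  obtain \<rho> \<Delta> where \<rho>: "\<rho> \<in> span T" and "simple_system T \<rho> \<Delta>"
    by (rule exists_simple_system)
  then interpret simple_system T \<rho> \<Delta> by simp
  have "cartan_coeff a b \<in> \<int>[\<phi>]" if "a \<in> \<Delta>" "b \<in> \<Delta>" for a b
    using assms(1) simple_root that by (simp add: root_shell_system_def)
  then obtain xs where xs: "H_chain xs" "set xs = \<Delta>" "length xs \<in> {2, 3, 4}"
    using simple_roots_form_H_chain[OF assms(2,3)] by blast
  have "rank_of T = card \<Delta>"
    using dim_eq_card[OF span_simple independent_simple] by (simp add: rank_of_def)
  also have "\<dots> = length xs"
    using xs distinct_card[of xs] by (simp add: H_chain_def)
  finally show ?thesis
    using xs(3) is_H_of_chain[OF \<rho> xs(1,2)] by auto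
qed

end
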